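(* Let $J$ be an involution on a Hilbert space $\mathfrak{H}$, and let $T$ be a self-adjoint operator on $\mathfrak{H}$ such that $\operatorname{Ker}(T)=\{0\}$ and the product $JT$ is accretive. Let $T=J'|T|$ be the polar decomposition of $T$. Then the involutions $J'$ and $J$ are in the acute case, and $$\vartheta(U)\le\frac12\arctan k(JT)\quad\left(\le\frac{\pi}{4}\right),$$ where $U$ is the direct rotation from $J$ to $J'$.
   Context: An involution on $\mathfrak{H}$ is a linear operator $J$ with $J^*=J$ and $J^2=I$. If $T$ is self-adjoint with $\operatorname{Ker}(T)=\{0\}$, then $J'$ in $T=J'|T|$ is the involution $\mathsf{E}_T((0,+\infty))-\mathsf{E}_T((-\infty,0))$, where $\mathsf{E}_T$ is the spectral measure of $T$. An operator $S$ is accretive if $\operatorname{Re}\langle x,Sx\rangle\ge0$ for all $x\in\operatorname{Dom}(S)$ with $\|x\|=1$. Its numerical range is $\mathcal{W}(S)=\{\langle x,Sx\rangle : x\in\operatorname{Dom}(S),\|x\|=1\}$, and the sector bound of an accretive $S$ is the finite or infinite number $k(S)=\sup_{z\in\mathcal{W}(S)\setminus\{0\}}\frac{|\operatorname{Im}z|}{\operatorname{Re}z}$ (the quotient being $+\infty$ if $\operatorname{Re}z=0$). Convention: $\arctan(+\infty)=\pi/2$. Involutions $J$ and $J'$ are in the acute case if $\operatorname{Ker}(I+J'J)=\{0\}$. A direct rotation from $J$ to $J'$ is a unitary operator $U$ on $\mathfrak{H}$ with $J'U=UJ$, $U^2=J'J$, and $\operatorname{Re}U\ge0$; in the acute case it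 exists and is unique. The spectral angle of a unitary operator $W$ is $\vartheta(W)=\sup_{z\in\operatorname{spec}(W)}|\arg z|$, with $\arg z\in(-\pi,\pi]$. *)

theory Defs
  imports "HOL-Analysis.Analysis"
begin

text \<open>Complex Hilbert spaces. The inner product is conjugate-linear in the first and linear in
  the second argument; the trivial space is not excluded.\<close>

class complex_hilbert = banach +
  fixes scaleC :: "complex \<Rightarrow> 'a \<Rightarrow> 'a" (infixr "*\<^sub>C" 75)
    and cinner :: "'a \<Rightarrow> 'a \<Rightarrow> complex"
  assumes scaleC_of_real: "complex_of_real r *\<^sub>C x = r *\<^sub>R x"
    and scaleC_add_right: "c *\<^sub>C (x + y) = c *\<^sub>C x + c *\<^sub>C y"
    and scaleC_add_left: "(c + d) *\<^sub>C x = c *\<^sub>C x + d *\<^sub>C x"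
    and scaleC_scaleC: "c *\<^sub>C d *\<^sub>C x = (c * d) *\<^sub>C x"
    and cinner_commute: "cinner x y = cnj (cinner y x)"
    and cinner_add_right: "cinner x (y + z) = cinner x y + cinner x z"
    and cinner_scaleC_right: "cinner x (c *\<^sub>C y) = c * cinner x y"
    and cinner_self: "cinner x x = complex_of_real ((norm x)\<^sup>2)"

instantiation complex :: complex_hilbert
begin

definition scaleC_complex :: "complex \<Rightarrow> complex \<Rightarrow> complex"
  where "scaleC_complex c x = c * x"

definition cinner_complex :: "complex \<Rightarrow> complex \<Rightarrow> complex"
  where "cinner_complex x y = cnj x * y"

instance
  by standard
    (auto simp: scaleC_complex_def cinner_complex_def algebra_simps scaleR_conv_of_real
      simp flip: complex_norm_square)

end


section \<open>Everywhere defined bounded operators\<close>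

definition bounded_clinear :: "('a::complex_hilbert \<Rightarrow> 'a) \<Rightarrow> bool" where
  "bounded_clinear B \<longleftrightarrow> bounded_linear B \<and> (\<forall>c x. B (c *\<^sub>C x) = c *\<^sub>C B x)"

text \<open>Meaningful for bounded operators, where the adjoint exists and is unique.\<close>

definition cadjoint :: "('a::complex_hilbert \<Rightarrow> 'a) \<Rightarrow> 'a \<Rightarrow> 'a" where
  "cadjoint B = (THE C. \<forall>x y. cinner (C x) y = cinner x (B y))"

text \<open>An involution is everywhere defined because \<open>J\<^sup>2 = I\<close>, hence bounded because it is
  self-adjoint.\<close>

definition involution :: "('a::complex_hilbert \<Rightarrow> 'a) \<Rightarrow> bool" where
  "involution J \<longleftrightarrow> bounded_clinear J \<and> cadjoint J = J \<and> J \<circ> J = id"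

definition unitary :: "('a::complex_hilbert \<Rightarrow> 'a) \<Rightarrow> bool" where
  "unitary U \<longleftrightarrow> bounded_clinear U \<and> cadjoint U \<circ> U = id \<and> U \<circ> cadjoint U = id"

definition partial_isometry :: "('a::complex_hilbert \<Rightarrow> 'a) \<Rightarrow> bool" where
  "partial_isometry V \<longleftrightarrow> bounded_clinear V \<and>
     (\<forall>x. (\<forall>y. V y = 0 \<longrightarrow> cinner y x = 0) \<longrightarrow> norm (V x) = norm x)"

definition real_part :: "('a::complex_hilbert \<Rightarrow> 'a) \<Rightarrow> 'a \<Rightarrow> 'a" where
  "real_part B = (\<lambda>x. (1/2) *\<^sub>C (B x + cadjoint B x))"

definition spectrum :: "('a::complex_hilbert \<Rightarrow> 'a) \<Rightarrow> complex set" where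
  "spectrum B = {z. \<not> (\<exists>R. bounded_clinear R \<and>
     R \<circ> (\<lambda>x. B x - z *\<^sub>C x) = id \<and> (\<lambda>x. B x - z *\<^sub>C x) \<circ> R = id)}"

text \<open>The supremum is taken in \<open>[0, \<infinity>]\<close>, so that it is 0 on the trivial space, where the spectrum
  is empty. \<open>Arg\<close> takes values in \<open>(-\<pi>, \<pi>]\<close>.\<close>

definition spectral_angle :: "('a::complex_hilbert \<Rightarrow> 'a) \<Rightarrow> ennreal" where
  "spectral_angle W = (SUP z\<in>spectrum W. ennreal \<bar>Arg z\<bar>)"


section \<open>Unbounded operators\<close>

text \<open>A not necessarily bounded, not necessarily everywhere defined operator is identified with
  its graph; its domain is \<open>Domain T\<close>, and equality of operators includes equality of the
  domains.\<close>

type_synonym 'a oper = "('a \<times> 'a) set"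

definition graph_of :: "('a \<Rightarrow> 'a) \<Rightarrow> 'a oper" where
  "graph_of B = {(x, B x) |x. True}"

text \<open>The product \<open>S T\<close>, with \<open>T\<close> applied first, on its maximal domain.\<close>

definition oper_times :: "'a oper \<Rightarrow> 'a oper \<Rightarrow> 'a oper" (infixl "\<odot>" 70) where
  "S \<odot> T = T O S"

definition linear_oper :: "'a::complex_hilbert oper \<Rightarrow> bool" where
  "linear_oper T \<longleftrightarrow> single_valued T \<and> (0, 0) \<in> T \<and>
     (\<forall>x y x' y'. (x, y) \<in> T \<longrightarrow> (x', y') \<in> T \<longrightarrow> (x + x', y + y') \<in> T) \<and>
     (\<forall>c x y. (x, y) \<in> T \<longrightarrow> (c *\<^sub>C x, c *\<^sub>C y) \<in> T)"

definition adjoint_oper :: "'a::complex_hilbert oper \<Rightarrow> 'a oper" where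
  "adjoint_oper T = {(u, v). \<forall>(x, y)\<in>T. cinner v x = cinner u y}"

definition self_adjoint :: "'a::complex_hilbert oper \<Rightarrow> bool" where
  "self_adjoint T \<longleftrightarrow> linear_oper T \<and> closure (Domain T) = UNIV \<and> adjoint_oper T = T"

definition nonneg_oper :: "'a::complex_hilbert oper \<Rightarrow> bool" where
  "nonneg_oper T \<longleftrightarrow> (\<forall>(x, y)\<in>T. cinner x y \<in> \<real>\<^sub>\<ge>\<^sub>0)"

definition ker_oper :: "'a::zero oper \<Rightarrow> 'a set" where
  "ker_oper T = {x. (x, 0) \<in> T}"

text \<open>\<open>A = |T|\<close>: the nonnegative self-adjoint square root of \<open>T\<^sup>* T\<close>, which for a densely defined
  closed operator \<open>T\<close> exists and is unique.\<close>

definition absolute_value :: "'a::complex_hilbert oper \<Rightarrow> 'a oper \<Rightarrow> bool" where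
  "absolute_value T A \<longleftrightarrow> self_adjoint A \<and> nonneg_oper A \<and> A \<odot> A = adjoint_oper T \<odot> T"

text \<open>\<open>T = V |T|\<close> with \<open>A = |T|\<close>.\<close>

definition polar_decomposition ::
    "'a::complex_hilbert oper \<Rightarrow> ('a \<Rightarrow> 'a) \<Rightarrow> 'a oper \<Rightarrow> bool" where
  "polar_decomposition T V A \<longleftrightarrow> absolute_value T A \<and> partial_isometry V \<and>
     ker_oper (graph_of V) = ker_oper T \<and> T = graph_of V \<odot> A"

definition numerical_range :: "'a::complex_hilbert oper \<Rightarrow> complex set" where
  "numerical_range S = {cinner x y |x y. (x, y) \<in> S \<and> norm x = 1}"

definition accretive :: "'a::complex_hilbert oper \<Rightarrow> bool" where
  "accretive S \<longleftrightarrow> linear_oper S \<and> (\<forall>x y. (x, y) \<in> S \<longrightarrow> norm x = 1 \<longrightarrow> 0 \<le> Re (cinner x y))"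

definition sector_bound :: "'a::complex_hilbert oper \<Rightarrow> ennreal" where
  "sector_bound S = (SUP z\<in>numerical_range S - {0}.
     if Re z = 0 then \<infinity> else ennreal (\<bar>Im z\<bar> / Re z))"

definition arctan_ext :: "ennreal \<Rightarrow> real" where
  "arctan_ext k = (if k = \<infinity> then pi / 2 else arctan (enn2real k))"


section \<open>Pairs of involutions\<close>

definition acute_case :: "('a::complex_hilbert \<Rightarrow> 'a) \<Rightarrow> ('a \<Rightarrow> 'a) \<Rightarrow> bool" where
  "acute_case J J' \<longleftrightarrow> involution J \<and> involution J' \<and>
     ker_oper (graph_of (\<lambda>x. x + J' (J x))) = {0}"

definition direct_rotation ::
    "('a::complex_hilbert \<Rightarrow> 'a) \<Rightarrow> ('a \<Rightarrow> 'a) \<Rightarrow> ('a \<Rightarrow> 'a) \<Rightarrow> bool" where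
  "direct_rotation J J' U \<longleftrightarrow> unitary U \<and> J' \<circ> U = U \<circ> J \<and> U \<circ> U = J' \<circ> J \<and>
     nonneg_oper (graph_of (real_part U))"

end

theory Submission
  imports Defs
begin

text \<open>Let \<open>A = |T|\<close>. Testing self-adjointness of \<open>T = J' A\<close> against its graph gives
  \<open>T = A J'\<^sup>*\<close>, and \<open>Ker T = {0}\<close> makes \<open>J'\<close> unitary. That \<open>J'\<close> is an involution commuting with
  \<open>A\<close> then follows from the positivity of \<open>A\<close> (\<open>intertwining_unitary_self_adjoint\<close>).

  Accretivity of \<open>J T\<close>, and more precisely the sector condition with \<open>\<theta> = arctan k(J T)\<close>, says that
  \<open>Re (g \<langle>x, J J' A x\<rangle>) \<ge> 0\<close> for the phases \<open>g = 1\<close> and \<open>g = exp (\<plusminus>\<i>(\<pi>/2 - \<theta>))\<close>. The heart of the proof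
  is that the factor \<open>A\<close> can be removed: \<open>Re (g \<langle>u, J J' u\<rangle>) \<ge> 0\<close> for every vector \<open>u\<close>
  (\<open>accretive_phase\<close>). Formally, \<open>J'\<close> is the limit of the iteration
  \<open>B \<mapsto> 2 B (I + B\<^sup>2)\<^sup>-\<^sup>1\<close> started at \<open>B = T\<close>, and each step preserves the sector condition on \<open>J B\<close>. In
  terms of the Cayley transform \<open>K = (I - A) (I + A)\<^sup>-\<^sup>1\<close>, where \<open>B = J' A\<close>, the step is
  \<open>K \<mapsto> K\<^sup>2\<close>, and the condition is
  \<open>Re (g \<langle>(I + K) u, J J' (I - K) u\<rangle>) \<ge> 0\<close>, in which every operator is bounded. It survives squaring of
  \<open>K\<close> (\<open>accretive_cayley_squaring\<close>), and the powers of \<open>K\<close> tend strongly to 0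
  (\<open>symmetric_contraction_powers_tendsto_zero\<close>) because \<open>A\<close> is injective.

  Consequently \<open>\<langle>u, J' J u\<rangle>\<close> lies in the sector \<open>|arg| \<le> \<theta>\<close>. This excludes \<open>J' J u = - u\<close> for
  \<open>u \<noteq> 0\<close>, which is the acute case. A point \<open>z\<close> of the spectrum of the direct rotation \<open>U\<close> is an
  approximate eigenvalue, so \<open>|z| = 1\<close>, \<open>Re z \<ge> 0\<close>, and \<open>z\<^sup>2\<close> lies in the same sector since
  \<open>U\<^sup>2 = J' J\<close>; hence \<open>|arg z| \<le> \<theta> / 2\<close>.\<close>

section \<open>Complex inner product spaces\<close>

lemma scaleC_minus_one [simp]: "(- 1) *\<^sub>C x = - (x::'a::complex_hilbert)"
  using scaleC_of_real[of "-1" x] by simp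

lemma scaleC_half [simp]: "(1/2) *\<^sub>C x = (1/2::real) *\<^sub>R (x::'a::complex_hilbert)"
  using scaleC_of_real[of "1/2" x] by simp

lemma scaleC_diff_right: "c *\<^sub>C (x - y) = c *\<^sub>C x - c *\<^sub>C (y::'a::complex_hilbert)"
  by (metis add_diff_cancel diff_add_cancel scaleC_add_right)

lemma cinner_scaleR_right: "cinner x (r *\<^sub>R y) = complex_of_real r * cinner x (y::'a::complex_hilbert)"
  by (metis cinner_scaleC_right scaleC_of_real)

lemma cinner_add_left: "cinner (x + y) z = cinner x z + cinner (y::'a::complex_hilbert) z"
  by (metis cinner_add_right cinner_commute complex_cnj_add)

lemma cinner_scaleC_left: "cinner (c *\<^sub>C x) y = cnj c * cinner x (y::'a::complex_hilbert)"
  by (metis cinner_commute cinner_scaleC_right complex_cnj_mult)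

lemma cinner_scaleR_left: "cinner (r *\<^sub>R x) y = complex_of_real r * cinner x (y::'a::complex_hilbert)"
  by (metis cinner_scaleC_left complex_cnj_complex_of_real scaleC_of_real)

lemma cinner_zero [simp]: "cinner x (0::'a::complex_hilbert) = 0" "cinner (0::'a) x = 0"
  using cinner_add_right[of x 0 0] cinner_add_left[of 0 0 x] by auto

lemma cinner_minus_right [simp]: "cinner x (- y) = - cinner x (y::'a::complex_hilbert)"
  using cinner_add_right[of x y "-y"] by (simp add: eq_neg_iff_add_eq_0 add.commute)

lemma cinner_minus_left [simp]: "cinner (- x) y = - cinner x (y::'a::complex_hilbert)"
  using cinner_add_left[of x "-x" y] by (simp add: eq_neg_iff_add_eq_0 add.commute)

lemma cinner_diff_right: "cinner x (y - z) = cinner x y - cinner x (z::'a::complex_hilbert)"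
  using cinner_add_right[of x y "-z"] by simp

lemma cinner_diff_left: "cinner (x - y) z = cinner x z - cinner (y::'a::complex_hilbert) z"
  using cinner_add_left[of x "-y" z] by simp

lemma Re_cinner_commute: "Re (cinner x y) = Re (cinner y (x::'a::complex_hilbert))"
  by (metis cinner_commute cnj.simps(1))

lemma Re_cinner_self: "Re (cinner x x) = (norm (x::'a::complex_hilbert))\<^sup>2"
  by (simp add: cinner_self)

lemma norm_add_sq:
  "(norm (x + y))\<^sup>2 = (norm x)\<^sup>2 + 2 * Re (cinner x y) + (norm (y::'a::complex_hilbert))\<^sup>2"
  using Re_cinner_commute[of x y]
  by (simp add: cinner_add_left cinner_add_right flip: Re_cinner_self)

lemma norm_diff_sq:
  "(norm (x - y))\<^sup>2 = (norm x)\<^sup>2 - 2 * Re (cinner x y) + (norm (y::'a::complex_hilbert))\<^sup>2"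
  using norm_add_sq[of x "-y"] by simp

lemma norm_scaleC: "norm (c *\<^sub>C x) = cmod c * norm (x::'a::complex_hilbert)"
proof -
  have "complex_of_real ((norm (c *\<^sub>C x))\<^sup>2) = cnj c * c * complex_of_real ((norm x)\<^sup>2)"
    using cinner_self[of "c *\<^sub>C x"] cinner_self[of x]
    by (simp add: cinner_scaleC_left cinner_scaleC_right mult_ac)
  also have "\<dots> = complex_of_real ((cmod c * norm x)\<^sup>2)"
    using complex_norm_square[of c] by (simp add: power_mult_distrib mult.commute)
  finally show ?thesis
    by (metis mult_nonneg_nonneg norm_ge_zero of_real_eq_iff power2_eq_iff_nonneg)
qed

lemma Re_cinner_le: "Re (cinner x y) \<le> norm x * norm (y::'a::complex_hilbert)"
proof (cases "x = 0 \<or> y = 0")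
  case False
  have "0 \<le> (norm (norm y *\<^sub>R x - norm x *\<^sub>R y))\<^sup>2" by simp
  also have "\<dots> = 2 * (norm x * norm y) * (norm x * norm y - Re (cinner x y))"
    unfolding norm_diff_sq
    by (simp add: cinner_scaleR_left cinner_scaleR_right power2_eq_square algebra_simps)
  finally show ?thesis
    using False by (simp add: zero_le_mult_iff mult_le_0_iff)
qed auto

lemma norm_cinner_le: "cmod (cinner x y) \<le> norm x * norm (y::'a::complex_hilbert)"
proof (cases "cinner x y = 0")
  case False
  define c where "c = cnj (cinner x y) / cmod (cinner x y)"
  have c1: "cmod c = 1" using False by (simp add: c_def norm_divide)
  have "c * cinner x y = cmod (cinner x y)"
    using False complex_norm_square[of "cinner x y"]
    by (simp add: c_def power2_eq_square mult.commute[of _ "cinner x y"] field_simps)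
  then have "cmod (cinner x y) = Re (cinner x (c *\<^sub>C y))"
    by (simp add: cinner_scaleC_right)
  also have "\<dots> \<le> norm x * norm y"
    using Re_cinner_le[of x "c *\<^sub>C y"] c1 by (simp add: norm_scaleC)
  finally show ?thesis .
qed simp

lemma bounded_bilinear_cinner: "bounded_bilinear (cinner :: 'a::complex_hilbert \<Rightarrow> _)"
proof
  show "\<exists>K. \<forall>a b::'a. norm (cinner a b) \<le> norm a * norm b * K"
    by (rule exI[of _ 1]) (simp add: norm_cinner_le)
qed (simp_all add: cinner_add_left cinner_add_right cinner_scaleR_left cinner_scaleR_right
      scaleR_conv_of_real)

lemmas tendsto_cinner = bounded_bilinear.tendsto[OF bounded_bilinear_cinner]

lemma orthogonal_dense_eq_zero:
  assumes "closure D = (UNIV :: 'a::complex_hilbert set)"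
    and "\<And>u. u \<in> D \<Longrightarrow> Re (cinner u w) = 0"
  shows "w = 0"
proof -
  have "w \<in> closure D" using assms(1) by simp
  then obtain f where f: "\<And>n. f n \<in> D" "f \<longlonglongrightarrow> w"
    unfolding closure_sequential by blast
  have "(\<lambda>n. Re (cinner (f n) w)) \<longlonglongrightarrow> Re (cinner w w)"
    by (intro tendsto_Re tendsto_cinner f tendsto_const)
  then have "Re (cinner w w) = 0"
    using assms(2) f(1) by (simp add: LIMSEQ_const_iff)
  then show ?thesis by (simp add: Re_cinner_self)
qed

lemma cinner_ext:
  assumes "\<And>y. cinner x y = cinner x' (y::'a::complex_hilbert)"
  shows "x = x'"
proof -
  have "cinner (x - x') (x - x') = 0"
    using assms by (simp only: cinner_diff_left) simp
  then show ?thesis by (simp add: cinner_self)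
qed

text \<open>Polarization: the norm determines the real part of the inner product, and the real part
  determines the imaginary part by rotating one argument.\<close>

lemma isometry_cinner:
  fixes V :: "'a::complex_hilbert \<Rightarrow> 'a"
  assumes add: "\<And>x y. V (x + y) = V x + V y" and sc: "\<And>c x. V (c *\<^sub>C x) = c *\<^sub>C V x"
    and iso: "\<And>x. norm (V x) = norm x"
  shows "cinner (V x) (V y) = cinner x y"
proof -
  have re: "Re (cinner (V x) (V y)) = Re (cinner x y)" for x y
    using norm_add_sq[of "V x" "V y"] norm_add_sq[of x y] iso[of "x + y"] iso[of x] iso[of y]
    by (simp add: add)
  have "Im (cinner (V x) (V y)) = Im (cinner x y)"
    using re[of x "(-\<i>) *\<^sub>C y"] by (simp add: sc cinner_scaleC_right)
  with re show ?thesis by (simp add: complex_eq_iff)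
qed


section \<open>Orthogonal complements and adjoints of bounded operators\<close>

text \<open>Subtracting from \<open>z - p\<close> its projection onto the line through \<open>m\<close> would shorten it.\<close>

lemma closest_point_orthogonal:
  fixes M :: "'a::complex_hilbert set"
  assumes sub: "\<And>c m. m \<in> M \<Longrightarrow> c *\<^sub>C m \<in> M" "\<And>m m'. m \<in> M \<Longrightarrow> m' \<in> M \<Longrightarrow> m + m' \<in> M"
    and p: "p \<in> M" and min: "\<And>m. m \<in> M \<Longrightarrow> norm (z - p) \<le> norm (z - m)" and m: "m \<in> M"
  shows "cinner m (z - p) = 0"
proof (cases "m = 0")
  case False
  define v where "v = z - p"
  define c where "c = cinner m v / complex_of_real ((norm m)\<^sup>2)"
  have "norm v \<le> norm (v - c *\<^sub>C m)"
    using min[OF sub(2)[OF p sub(1)[OF m, of c]]] by (simp add: v_def algebra_simps)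
  then have "(norm v)\<^sup>2 \<le> (norm (v - c *\<^sub>C m))\<^sup>2" by simp
  then have *: "2 * Re (cinner v (c *\<^sub>C m)) \<le> (norm (c *\<^sub>C m))\<^sup>2"
    by (simp add: norm_diff_sq)
  have "cinner v m = cnj (cinner m v)" by (rule cinner_commute)
  then have "cinner v (c *\<^sub>C m) = complex_of_real ((cmod (cinner m v))\<^sup>2 / (norm m)\<^sup>2)"
    by (simp add: cinner_scaleC_right c_def complex_norm_square flip: of_real_power)
  then have 1: "Re (cinner v (c *\<^sub>C m)) = (cmod (cinner m v))\<^sup>2 / (norm m)\<^sup>2" by simp
  have 2: "(norm (c *\<^sub>C m))\<^sup>2 = (cmod (cinner m v))\<^sup>2 / (norm m)\<^sup>2"
    using False
    by (simp add: norm_scaleC c_def norm_divide norm_mult power2_eq_square)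
  have "(cmod (cinner m v))\<^sup>2 / (norm m)\<^sup>2 \<le> 0" using * 1 2 by linarith
  then have "cinner m v = 0" using False by (simp add: divide_le_0_iff)
  then show ?thesis by (simp add: v_def)
qed simp

lemma closest_point_exists:
  fixes M :: "'a::complex_hilbert set"
  assumes "closed M" and "M \<noteq> {}"
    and mid: "\<And>m m'. m \<in> M \<Longrightarrow> m' \<in> M \<Longrightarrow> (1/2::real) *\<^sub>R (m + m') \<in> M"
  obtains p where "p \<in> M" "\<And>m. m \<in> M \<Longrightarrow> norm (z - p) \<le> norm (z - m)"
proof -
  define d where "d = (INF m\<in>M. (norm (z - m))\<^sup>2)"
  have bdd: "bdd_below ((\<lambda>m. (norm (z - m))\<^sup>2) ` M)" by (rule bdd_belowI[of _ 0]) auto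
  have low: "d \<le> (norm (z - m))\<^sup>2" if "m \<in> M" for m
    unfolding d_def by (rule cINF_lower[OF bdd that])
  have "\<exists>m\<in>M. (norm (z - m))\<^sup>2 < d + 1 / Suc n" for n
    using cINF_less_iff[OF \<open>M \<noteq> {}\<close> bdd, of "d + 1 / Suc n"] by (simp add: d_def)
  then obtain f where fM: "\<And>n. f n \<in> M" and f: "\<And>n. (norm (z - f n))\<^sup>2 < d + 1 / Suc n"
    by metis
  \<comment> \<open>The parallelogram law bounds the distance of two almost minimizing points, because their
    midpoint is no better than the infimum.\<close>
  have par: "(norm (f i - f j))\<^sup>2 \<le> 2 / Suc i + 2 / Suc j" for i j
  proof -
    define a b where "a = z - f i" and "b = z - f j"
    have "(norm (a - b))\<^sup>2 = 2 * (norm a)\<^sup>2 + 2 * (norm b)\<^sup>2 - (norm (a + b))\<^sup>2"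
      by (simp add: norm_diff_sq norm_add_sq)
    moreover have "a + b = 2 *\<^sub>R (z - (1/2::real) *\<^sub>R (f i + f j))"
      by (simp add: a_def b_def scaleR_2 algebra_simps)
    then have "(norm (a + b))\<^sup>2 = 4 * (norm (z - (1/2::real) *\<^sub>R (f i + f j)))\<^sup>2"
      by (simp add: power_mult_distrib)
    moreover have "norm (a - b) = norm (f i - f j)"
      by (simp add: a_def b_def norm_minus_commute)
    ultimately show ?thesis
      using f[of i] f[of j] low[OF mid[OF fM fM, of i j]] by (simp add: a_def b_def)
  qed
  have "Cauchy f"
  proof (rule metric_CauchyI)
    fix e :: real assume e: "e > 0"
    obtain N where N: "1 / Suc N < e\<^sup>2 / 4"
      using reals_Archimedean[of "e\<^sup>2 / 4"] e by (auto simp: inverse_eq_divide)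
    have "dist (f i) (f j) < e" if "i \<ge> N" "j \<ge> N" for i j
    proof -
      have "1 / Suc i \<le> 1 / Suc N" "1 / Suc j \<le> 1 / Suc N"
        using that by (auto intro!: divide_left_mono)
      then have "(norm (f i - f j))\<^sup>2 < e\<^sup>2" using par[of i j] N by linarith
      then show ?thesis using e by (simp add: dist_norm power2_less_imp_less)
    qed
    then show "\<exists>M. \<forall>m\<ge>M. \<forall>n\<ge>M. dist (f m) (f n) < e" by blast
  qed
  then obtain p where p: "f \<longlonglongrightarrow> p" using Cauchy_convergent convergent_def by blast
  have "p \<in> M" using closed_sequentially[OF \<open>closed M\<close> _ p] fM by blast
  have "(\<lambda>n. (norm (z - f n))\<^sup>2) \<longlonglongrightarrow> (norm (z - p))\<^sup>2"
    by (intro tendsto_intros p)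
  moreover have "(\<lambda>n. d + 1 / Suc n) \<longlonglongrightarrow> d + 0"
    by (intro tendsto_add tendsto_const LIMSEQ_Suc[OF lim_1_over_n])
  ultimately have "(norm (z - p))\<^sup>2 \<le> d + 0"
    using f by (intro LIMSEQ_le) (auto intro: less_imp_le)
  then have "norm (z - p) \<le> norm (z - m)" if "m \<in> M" for m
    using low[OF that] by (intro power2_le_imp_le[OF _ norm_ge_zero]) linarith
  with \<open>p \<in> M\<close> show thesis by (rule that)
qed

text \<open>This consequence of the projection theorem turns every surjectivity claim below into two
  checks: that a range is closed, and that only 0 is orthogonal to it.\<close>

lemma closed_subspace_eq_UNIV:
  fixes M :: "'a::complex_hilbert set"
  assumes "closed M" and ne: "M \<noteq> {}"
    and sub: "\<And>c m. m \<in> M \<Longrightarrow> c *\<^sub>C m \<in> M" "\<And>m m'. m \<in> M \<Longrightarrow> m' \<in> M \<Longrightarrow> m + m' \<in> M"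
    and orth: "\<And>v. (\<And>m. m \<in> M \<Longrightarrow> cinner m v = 0) \<Longrightarrow> v = 0"
  shows "M = UNIV"
proof -
  have "z \<in> M" for z
  proof -
    have "(1/2::real) *\<^sub>R (m + m') \<in> M" if "m \<in> M" "m' \<in> M" for m m'
      using sub(1)[OF sub(2)[OF that], of "1/2"] by simp
    then obtain p where p: "p \<in> M" "\<And>m. m \<in> M \<Longrightarrow> norm (z - p) \<le> norm (z - m)"
      using closest_point_exists[OF assms(1) ne] by blast
    have "z - p = 0"
      by (rule orth, rule closest_point_orthogonal[of M p z]) (use sub p in auto)
    with p show ?thesis by simp
  qed
  then show ?thesis by auto
qed

lemma bounded_clinearD:
  assumes "bounded_clinear B"
  shows "bounded_linear B" "B (x + y) = B x + B y" "B (x - y) = B x - B y"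
    "B (c *\<^sub>C x) = c *\<^sub>C B x" "B 0 = 0" "B (r *\<^sub>R x) = r *\<^sub>R B x"
  using assms linear_simps[of B] by (auto simp: bounded_clinear_def)

text \<open>A nonzero functional is determined by its kernel up to a factor, so a suitable multiple of
  a vector orthogonal to the kernel represents it.\<close>

lemma riesz_representation:
  fixes f :: "'a::complex_hilbert \<Rightarrow> complex"
  assumes lin: "bounded_linear f" and sc: "\<And>c x. f (c *\<^sub>C x) = c * f x"
  obtains w where "\<And>y. f y = cinner w y"
proof (cases "\<forall>y. f y = 0")
  case True
  then show ?thesis using that[of 0] by simp
next
  case False
  define M where "M = {y. f y = 0}"
  interpret f: bounded_linear f by fact
  have "closed M" unfolding M_def
    by (intro closed_Collect_eq continuous_intros f.continuous_on)
  moreover have "M \<noteq> UNIV" using False by (auto simp: M_def)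
  moreover have "0 \<in> M" by (simp add: M_def f.zero)
  moreover have "c *\<^sub>C m \<in> M" if "m \<in> M" for c m using that by (simp add: M_def sc)
  moreover have "m + m' \<in> M" if "m \<in> M" "m' \<in> M" for m m' using that by (simp add: M_def f.add)
  ultimately obtain v where v: "\<And>m. m \<in> M \<Longrightarrow> cinner m v = 0" "v \<noteq> 0"
    using closed_subspace_eq_UNIV[of M] by (metis empty_iff)
  then have fv: "f v \<noteq> 0" using v(1)[of v] by (auto simp: M_def cinner_self)
  have "f y = cinner ((cnj (f v) / complex_of_real ((norm v)\<^sup>2)) *\<^sub>C v) y" for y
  proof -
    have "f v *\<^sub>C y - f y *\<^sub>C v \<in> M" by (simp add: M_def f.diff sc)
    then have "cinner v (f v *\<^sub>C y - f y *\<^sub>C v) = 0"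
      using v(1) by (metis cinner_commute complex_cnj_zero)
    then have "f v * cinner v y = f y * complex_of_real ((norm v)\<^sup>2)"
      by (simp add: cinner_diff_right cinner_scaleC_right cinner_self)
    then show ?thesis using v(2) by (simp add: cinner_scaleC_left field_simps)
  qed
  then show ?thesis by (rule that)
qed

lemma cadjoint_eqI:
  assumes "\<And>x y. cinner (C x) y = cinner x (B y)"
  shows "cadjoint B = C"
  unfolding cadjoint_def
proof (rule the_equality)
  fix C' assume "\<forall>x y. cinner (C' x) y = cinner x (B y)"
  then have "C' x = C x" for x using assms by (intro cinner_ext[of "C' x" "C x"]) simp
  then show "C' = C" by (rule ext)
qed (use assms in blast)

text \<open>The Riesz representation supplies the adjoint, so that the definite description in
  \<^const>\<open>cadjoint\<close> denotes what it should.\<close>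

lemma cinner_cadjoint:
  assumes B: "bounded_clinear B"
  shows "cinner (cadjoint B x) y = cinner x (B y)"
proof -
  have "\<exists>w. \<forall>y. cinner x (B y) = cinner w y" for x
  proof -
    have "bounded_linear (\<lambda>y. cinner x (B y))"
      using bounded_bilinear.bounded_linear_right[OF bounded_bilinear_cinner]
        bounded_clinearD(1)[OF B] by (rule bounded_linear_compose)
    then show ?thesis
      using riesz_representation[of "\<lambda>y. cinner x (B y)"]
      by (metis bounded_clinearD(4)[OF B] cinner_scaleC_right)
  qed
  then obtain C where "\<And>x y. cinner x (B y) = cinner (C x) y" by metis
  then show ?thesis using cadjoint_eqI[of C B] by simp
qed

section \<open>The spectrum of a unitary operator\<close>

lemma unitary_cinner:
  assumes "unitary U"
  shows "cinner (U x) (U y) = cinner x y" "norm (U x) = norm x"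
proof -
  have "cinner (cadjoint U (U x)) y = cinner (U x) (U y)" for x y
    using assms by (simp add: cinner_cadjoint unitary_def)
  then show *: "cinner (U x) (U y) = cinner x y" for x y
    using assms by (metis comp_apply id_apply unitary_def)
  show "norm (U x) = norm x"
    using *[of x x] by (simp add: cinner_self flip: of_real_power)
qed

lemma closed_range_bounded_below:
  fixes N :: "'a::banach \<Rightarrow> 'a"
  assumes lin: "bounded_linear N" and e: "e > 0" and bel: "\<And>x. e * norm x \<le> norm (N x)"
  shows "closed (range N)"
proof (rule complete_imp_closed)
  show "complete (range N)"
    by (rule complete_isometric_image[OF e subspace_UNIV lin])
      (use bel complete_UNIV in auto)
qed

text \<open>Otherwise \<open>U - z\<close> is bounded below, hence has closed range; that range is also dense since
  \<open>U - z\<close> is normal, and so \<open>U - z\<close> has a bounded inverse.\<close>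

lemma unitary_approximate_eigenvector:
  assumes U: "unitary U" and z: "z \<in> spectrum U" and e: "e > 0"
  shows "\<exists>x. norm x = 1 \<and> norm (U x - z *\<^sub>C x) < e"
proof (rule ccontr)
  assume "\<not> ?thesis"
  then have unit: "e \<le> norm (U x - z *\<^sub>C x)" if "norm x = 1" for x
    using that by (meson not_le)
  define N where "N = (\<lambda>x. U x - z *\<^sub>C x)"
  have bc: "bounded_clinear U" using U by (simp add: unitary_def)
  note Us = bounded_clinearD[OF bc]
  have Nadd: "N (x + y) = N x + N y" for x y by (simp add: N_def Us scaleC_add_right)
  have Nsc: "N (c *\<^sub>C x) = c *\<^sub>C N x" for c x
    by (simp add: N_def Us scaleC_diff_right scaleC_scaleC mult.commute)
  have NscR: "N (r *\<^sub>R x) = r *\<^sub>R N x" for r x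
    using Nsc[of "complex_of_real r" x] by (simp add: scaleC_of_real)
  have bN: "bounded_linear N"
  proof (rule bounded_linear_intro[where K="1 + cmod z"])
    show "norm (N x) \<le> norm x * (1 + cmod z)" for x
      unfolding N_def
      by (rule order_trans[OF norm_triangle_ineq4])
        (simp add: unitary_cinner(2)[OF U] norm_scaleC algebra_simps)
  qed (simp_all add: Nadd NscR)
  have bel: "e * norm x \<le> norm (N x)" for x
  proof (cases "x = 0")
    case False
    have "e \<le> norm (N ((1 / norm x) *\<^sub>R x))"
      unfolding N_def by (rule unit) (use False in simp)
    then show ?thesis using False by (simp only: NscR) (simp add: field_simps)
  qed (simp add: linear_0[OF bounded_linear.linear[OF bN]])
  \<comment> \<open>\<open>U - z\<close> is normal, so a vector orthogonal to its range also lies in its kernel.\<close>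
  have "range N = UNIV"
  proof (rule closed_subspace_eq_UNIV)
    show "closed (range N)" by (rule closed_range_bounded_below[OF bN e bel])
    show "c *\<^sub>C m \<in> range N" if "m \<in> range N" for c m using that
      by (auto simp flip: Nsc)
    show "m + m' \<in> range N" if "m \<in> range N" "m' \<in> range N" for m m'
      using that
      by (auto simp flip: Nadd)
    fix v assume orth: "\<And>m. m \<in> range N \<Longrightarrow> cinner m v = 0"
    define v' where "v' = cadjoint U v"
    have v': "v = U v'" using U by (metis comp_apply id_apply unitary_def v'_def)
    have "cinner x (v' - cnj z *\<^sub>C v) = cinner (N x) v" for x
      by (simp add: N_def cinner_diff_left cinner_diff_right cinner_scaleC_left
          cinner_scaleC_right v' unitary_cinner[OF U])
    then have "cinner (v' - cnj z *\<^sub>C v) (v' - cnj z *\<^sub>C v) = 0" using orth by simp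
    then have "v' = cnj z *\<^sub>C v" by (simp add: cinner_self)
    then have Uv: "v = cnj z *\<^sub>C U v" using v' by (metis Us(4))
    have "(norm (N v))\<^sup>2 = (norm (U v))\<^sup>2 - 2 * Re (cinner (U v) (z *\<^sub>C v)) + (norm (z *\<^sub>C v))\<^sup>2"
      by (simp add: N_def norm_diff_sq)
    moreover have "cinner (U v) (z *\<^sub>C v) = cinner v v"
      by (subst (3) Uv) (simp add: cinner_scaleC_left cinner_scaleC_right)
    moreover have "norm (z *\<^sub>C v) = norm v"
      by (subst (2) Uv) (simp add: norm_scaleC unitary_cinner(2)[OF U])
    ultimately have "N v = 0" by (simp add: unitary_cinner(2)[OF U] Re_cinner_self)
    then show "v = 0" using bel[of v] e by (simp add: mult_le_0_iff)
  qed auto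
  moreover have inj: "N x = N y \<Longrightarrow> x = y" for x y
    using bel[of "x - y"] e by (simp add: linear_diff[OF bounded_linear.linear[OF bN]] mult_le_0_iff)
  ultimately obtain R where NR: "\<And>y. N (R y) = y" by (metis surjD)
  have RN: "R (N x) = x" for x by (rule inj) (simp add: NR)
  have Rsc: "R (c *\<^sub>C x) = c *\<^sub>C R x" for c x by (rule inj) (simp add: NR Nsc)
  have "bounded_linear R"
  proof (rule bounded_linear_intro[where K="1/e"])
    show "R (x + y) = R x + R y" for x y by (rule inj) (simp add: NR Nadd)
    show "R (r *\<^sub>R x) = r *\<^sub>R R x" for r x by (rule inj) (simp add: NR NscR)
    show "norm (R x) \<le> norm x * (1/e)" for x
      using bel[of "R x"] e by (simp add: NR field_simps)
  qed
  then have "bounded_clinear R" by (simp add: bounded_clinear_def Rsc)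
  then have "z \<notin> spectrum U"
    unfolding spectrum_def using NR RN by (auto simp: N_def fun_eq_iff)
  with z show False by simp
qed

text \<open>Along approximate eigenvectors \<open>x\<close> for \<open>z\<close> the pairs \<open>(\<langle>x, U x\<rangle>, \<langle>x, U\<^sup>2 x\<rangle>)\<close> converge to
  \<open>(z, z\<^sup>2)\<close>. Closed conditions on the numerical ranges of \<open>U\<close> and \<open>U\<^sup>2\<close> therefore pass to the spectrum of
  \<open>U\<close>; here they will be the half-plane for \<open>U\<close> and the sector for \<open>U\<^sup>2\<close>.\<close>

lemma unitary_spectrum_closed:
  assumes U: "unitary U" and z: "z \<in> spectrum U"
    and cl: "closed S" and S: "\<And>x. norm x = 1 \<Longrightarrow> (cinner x (U x), cinner x (U (U x))) \<in> S"
  shows "cmod z = 1" and "(z, z\<^sup>2) \<in> S"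
proof -
  have "\<exists>x. norm x = 1 \<and> norm (U x - z *\<^sub>C x) < 1 / Suc n" for n
    by (rule unitary_approximate_eigenvector[OF U z]) simp
  then obtain f where f: "\<And>n. norm (f n) = 1"
    and less: "\<And>n. norm (U (f n) - z *\<^sub>C f n) < 1 / Suc n" by metis
  have bc: "bounded_clinear U" using U by (simp add: unitary_def)
  note Us = bounded_clinearD[OF bc]
  define r where "r n = U (f n) - z *\<^sub>C f n" for n
  have "(\<lambda>n. norm (r n)) \<longlonglongrightarrow> 0"
    by (rule tendsto_sandwich[OF _ _ tendsto_const LIMSEQ_Suc[OF lim_1_over_n]])
      (auto simp: r_def intro!: always_eventually less_imp_le[OF less, simplified])
  then have r0: "r \<longlonglongrightarrow> 0" by (rule tendsto_norm_zero_cancel)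
  have Uf: "U (f n) = z *\<^sub>C f n + r n" for n by (simp add: r_def)
  have inner0: "(\<lambda>n. cinner (f n) (q n)) \<longlonglongrightarrow> 0" if "q \<longlonglongrightarrow> 0" for q
    by (rule Lim_null_comparison[OF _ tendsto_norm_zero[OF that]])
      (use norm_cinner_le[of "f _" "q _"] f in auto)
  have one: "cinner (f n) (f n) = 1" for n by (simp add: cinner_self f)
  have Ur0: "(\<lambda>n. U (r n)) \<longlonglongrightarrow> 0"
    using bounded_linear.tendsto[OF Us(1) r0] Us(5) by simp
  have l1: "(\<lambda>n. cinner (f n) (U (f n))) \<longlonglongrightarrow> z"
    using tendsto_add[OF tendsto_const[of z] inner0[OF r0]]
    by (simp add: Uf cinner_add_right cinner_scaleC_right one)
  have "(\<lambda>n. z * cinner (f n) (U (f n)) + cinner (f n) (U (r n))) \<longlonglongrightarrow> z * z + 0"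
    by (intro tendsto_add tendsto_mult tendsto_const l1 inner0 Ur0)
  moreover have "U (U (f n)) = z *\<^sub>C U (f n) + U (r n)" for n
    by (subst Uf) (simp add: Us)
  ultimately have l2: "(\<lambda>n. cinner (f n) (U (U (f n)))) \<longlonglongrightarrow> z\<^sup>2"
    by (simp add: cinner_add_right cinner_scaleC_right power2_eq_square)
  show "(z, z\<^sup>2) \<in> S"
    by (rule closed_sequentially[OF cl _ tendsto_Pair[OF l1 l2]]) (use S f in auto)
  have "(\<lambda>n. norm (U (f n) - r n)) \<longlonglongrightarrow> cmod z"
    by (simp add: Uf norm_scaleC f)
  moreover have "(\<lambda>n. norm (U (f n) - r n)) \<longlonglongrightarrow> 1"
  proof (rule tendsto_sandwich[of "\<lambda>n. 1 - norm (r n)" _ _ "\<lambda>n. 1 + norm (r n)"])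
    show "(\<lambda>n. 1 - norm (r n)) \<longlonglongrightarrow> 1" "(\<lambda>n. 1 + norm (r n)) \<longlonglongrightarrow> 1"
      using tendsto_diff[OF tendsto_const[of 1] tendsto_norm_zero[OF r0]]
        tendsto_add[OF tendsto_const[of 1] tendsto_norm_zero[OF r0]] by simp_all
    show "\<forall>\<^sub>F n in sequentially. 1 - norm (r n) \<le> norm (U (f n) - r n)"
      using norm_triangle_ineq2[of "U (f _)" "r _"] by (simp add: unitary_cinner(2)[OF U] f)
    show "\<forall>\<^sub>F n in sequentially. norm (U (f n) - r n) \<le> 1 + norm (r n)"
      using norm_triangle_ineq4[of "U (f _)" "r _"] by (simp add: unitary_cinner(2)[OF U] f)
  qed
  ultimately show "cmod z = 1" by (rule LIMSEQ_unique)
qed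

lemma unitary_cadjoint:
  assumes "unitary U"
  shows "cadjoint U (U x) = x" "U (cadjoint U x) = x"
  using assms by (auto simp: unitary_def fun_eq_iff)

lemma surj_isometry_unitary:
  assumes V: "bounded_clinear V" and iso: "\<And>x. norm (V x) = norm x" and surj: "surj V"
  shows "unitary V"
proof -
  have "cinner (V x) (V y) = cinner x y" for x y
    by (rule isometry_cinner) (simp_all add: bounded_clinearD[OF V] iso)
  then have *: "cadjoint V (V x) = x" for x
    by (intro cinner_ext[of "cadjoint V (V x)" x]) (simp add: cinner_cadjoint[OF V])
  have "V (cadjoint V x) = x" for x using surj * by (metis surjD)
  with * V show ?thesis by (simp add: unitary_def fun_eq_iff)
qed


section \<open>Nonnegative self-adjoint operators\<close>

lemma self_adjointD:
  assumes "self_adjoint A"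
  shows "(0, 0) \<in> A"
    "\<And>x y x' y'. (x, y) \<in> A \<Longrightarrow> (x', y') \<in> A \<Longrightarrow> (x + x', y + y') \<in> A"
    "\<And>c x y. (x, y) \<in> A \<Longrightarrow> (c *\<^sub>C x, c *\<^sub>C y) \<in> A"
    "\<And>r x y. (x, y) \<in> A \<Longrightarrow> (r *\<^sub>R x, r *\<^sub>R y) \<in> A"
    "\<And>x y x' y'. (x, y) \<in> A \<Longrightarrow> (x', y') \<in> A \<Longrightarrow> (x - x', y - y') \<in> A"
proof -
  have l: "linear_oper A" using assms by (simp add: self_adjoint_def)
  show "(0, 0) \<in> A" using l by (auto simp: linear_oper_def)
  show add: "\<And>x y x' y'. (x, y) \<in> A \<Longrightarrow> (x', y') \<in> A \<Longrightarrow> (x + x', y + y') \<in> A"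
    using l by (auto simp: linear_oper_def)
  show sc: "\<And>c x y. (x, y) \<in> A \<Longrightarrow> (c *\<^sub>C x, c *\<^sub>C y) \<in> A"
    using l by (auto simp: linear_oper_def)
  show "\<And>r x y. (x, y) \<in> A \<Longrightarrow> (r *\<^sub>R x, r *\<^sub>R y) \<in> A"
    using sc[of _ _ "complex_of_real _"] by (simp add: scaleC_of_real)
  show "\<And>x y x' y'. (x, y) \<in> A \<Longrightarrow> (x', y') \<in> A \<Longrightarrow> (x - x', y - y') \<in> A"
    using add sc[of _ _ "-1"] by (metis diff_conv_add_uminus scaleC_minus_one)
qed

lemma self_adjoint_iff:
  assumes "self_adjoint A"
  shows "(u, v) \<in> A \<longleftrightarrow> (\<forall>x y. (x, y) \<in> A \<longrightarrow> cinner v x = cinner u y)"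
proof -
  have "(u, v) \<in> A \<longleftrightarrow> (u, v) \<in> adjoint_oper A" using assms by (simp add: self_adjoint_def)
  also have "\<dots> \<longleftrightarrow> (\<forall>x y. (x, y) \<in> A \<longrightarrow> cinner v x = cinner u y)"
    by (auto simp: adjoint_oper_def)
  finally show ?thesis .
qed

text \<open>Adjoints are closed operators, by continuity of the inner product.\<close>

lemma self_adjoint_closed:
  assumes sa: "self_adjoint A" and "\<And>n. (f n, g n) \<in> A" and f: "f \<longlonglongrightarrow> x" and g: "g \<longlonglongrightarrow> y"
  shows "(x, y) \<in> A"
  unfolding self_adjoint_iff[OF sa, of x y]
proof (intro allI impI)
  fix u v assume "(u, v) \<in> A"
  then have "cinner (g n) u = cinner (f n) v" for n
    using assms(2) self_adjoint_iff[OF sa, of "f n" "g n"] by blast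
  moreover have "(\<lambda>n. cinner (g n) u) \<longlonglongrightarrow> cinner y u" "(\<lambda>n. cinner (f n) v) \<longlonglongrightarrow> cinner x v"
    by (intro tendsto_cinner f g tendsto_const)+
  ultimately show "cinner y u = cinner x v" by (simp add: LIMSEQ_unique)
qed

lemma nonneg_operD:
  assumes "nonneg_oper A" "(x, y) \<in> A"
  shows "0 \<le> Re (cinner x y)"
  using assms by (auto simp: nonneg_oper_def complex_nonneg_Reals_iff)

text \<open>A nonnegative form that vanishes at \<open>x\<close> has a minimum there, so its derivative
  \<open>Re \<langle>u, w\<rangle>\<close> vanishes in every direction \<open>u\<close> of the dense domain.\<close>

lemma nonneg_cinner_eq_zero:
  assumes sa: "self_adjoint A" and nn: "nonneg_oper A"
    and xw: "(x, w) \<in> A" and 0: "Re (cinner x w) = 0"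
  shows "w = 0"
proof (rule orthogonal_dense_eq_zero)
  show "closure (Domain A) = UNIV" using sa by (simp add: self_adjoint_def)
  fix u assume "u \<in> Domain A"
  then obtain v where uv: "(u, v) \<in> A" by auto
  define b c where "b = Re (cinner u w)" and "c = Re (cinner u v)"
  have c: "c \<ge> 0" using nonneg_operD[OF nn uv] by (simp add: c_def)
  have "cinner w u = cinner x v" using self_adjoint_iff[OF sa, of x w] xw uv by blast
  then have xv: "Re (cinner x v) = b" by (metis Re_cinner_commute b_def)
  have ineq: "0 \<le> 2 * t * b + t\<^sup>2 * c" for t :: real
    using nonneg_operD[OF nn self_adjointD(2)[OF sa xw self_adjointD(4)[OF sa uv, of t]]]
    by (simp add: cinner_add_left cinner_add_right cinner_scaleR_left cinner_scaleR_right 0 xv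
        flip: b_def c_def) (simp add: power2_eq_square algebra_simps)
  \<comment> \<open>\<open>t = - b / c\<close> would be the minimum; the shifted denominator avoids the case \<open>c = 0\<close>.\<close>
  have "0 \<le> 2 * (- b / (c + 1)) * b + (- b / (c + 1))\<^sup>2 * c" by (rule ineq)
  also have "\<dots> = - (b\<^sup>2 * (c + 2) / (c + 1)\<^sup>2)"
    using c by (simp add: divide_simps power2_eq_square) (simp add: algebra_simps)
  finally have "b\<^sup>2 * (c + 2) / (c + 1)\<^sup>2 \<le> 0" by simp
  then have "b = 0" using c by (simp add: divide_le_0_iff mult_le_0_iff)
  then show "Re (cinner u w) = 0" by (simp add: b_def)
qed

text \<open>The first bound makes \<open>I + A\<close> injective with closed range; the second makes the Cayley
  transform \<open>x + w \<mapsto> x - w\<close> a contraction.\<close>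

lemma nonneg_norm_add:
  assumes "nonneg_oper A" "(x, w) \<in> A"
  shows "norm x \<le> norm (x + w)" "norm (x - w) \<le> norm (x + w)"
proof -
  have *: "0 \<le> Re (cinner x w)" by (rule nonneg_operD[OF assms])
  have "(norm x)\<^sup>2 \<le> (norm (x + w))\<^sup>2" "(norm (x - w))\<^sup>2 \<le> (norm (x + w))\<^sup>2"
    using * by (simp_all add: norm_add_sq norm_diff_sq)
  then show "norm x \<le> norm (x + w)" "norm (x - w) \<le> norm (x + w)"
    by (auto intro: power2_le_imp_le)
qed

text \<open>The range of \<open>I + A\<close> is closed since \<open>\<parallel>x\<parallel> \<le> \<parallel>(I + A) x\<parallel>\<close>. A vector \<open>v\<close> orthogonal to it satisfies
  \<open>A v = - v\<close>, which nonnegativity allows only for \<open>v = 0\<close>.\<close>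

lemma range_id_plus_nonneg:
  assumes sa: "self_adjoint A" and nn: "nonneg_oper A"
  obtains x w where "(x, w) \<in> A" "y = x + w"
proof -
  define M where "M = {x + w |x w. (x, w) \<in> A}"
  have "M = UNIV"
  proof (rule closed_subspace_eq_UNIV)
    show "closed M" unfolding closed_sequential_limits
    proof (intro allI impI, elim conjE)
      fix h l assume "\<forall>n. h n \<in> M" and h: "h \<longlonglongrightarrow> l"
      then have "\<forall>n. \<exists>x w. (x, w) \<in> A \<and> h n = x + w" unfolding M_def by blast
      then obtain f g where fg: "\<And>n. (f n, g n) \<in> A" and hfg: "\<And>n. h n = f n + g n" by metis
      have d: "h m - h n = (f m - f n) + (g m - g n)" for m n by (simp add: hfg)
      have "Cauchy f"
      proof (rule metric_CauchyI)
        fix e :: real assume "e > 0"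
        then obtain N where N: "\<And>m n. m \<ge> N \<Longrightarrow> n \<ge> N \<Longrightarrow> dist (h m) (h n) < e"
          using LIMSEQ_imp_Cauchy[OF h] by (meson metric_CauchyD)
        have "dist (f m) (f n) \<le> dist (h m) (h n)" for m n
          unfolding dist_norm d by (rule nonneg_norm_add(1)[OF nn self_adjointD(5)[OF sa fg fg]])
        then show "\<exists>M. \<forall>m\<ge>M. \<forall>n\<ge>M. dist (f m) (f n) < e"
          using N by (meson le_less_trans)
      qed
      then obtain x where x: "f \<longlonglongrightarrow> x" using Cauchy_convergent convergent_def by blast
      have g: "g \<longlonglongrightarrow> l - x" using tendsto_diff[OF h x] by (simp add: hfg)
      have "(x, l - x) \<in> A" by (rule self_adjoint_closed[OF sa fg x g])
      then show "l \<in> M" unfolding M_def by force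
    qed
    show "M \<noteq> {}" using self_adjointD(1)[OF sa] by (auto simp: M_def)
    show "c *\<^sub>C m \<in> M" if m: "m \<in> M" for c m
    proof -
      obtain x w where "(x, w) \<in> A" "m = x + w" using m unfolding M_def by blast
      then show ?thesis using self_adjointD(3)[OF sa, of x w c] scaleC_add_right[of c x w]
        unfolding M_def by blast
    qed
    show "m + m' \<in> M" if mm: "m \<in> M" "m' \<in> M" for m m'
    proof -
      obtain x w x' w' where "(x, w) \<in> A" "m = x + w" "(x', w') \<in> A" "m' = x' + w'"
        using mm unfolding M_def by blast
      moreover have "(x + w) + (x' + w') = (x + x') + (w + w')" by simp
      ultimately show ?thesis using self_adjointD(2)[OF sa] unfolding M_def by blast
    qed
    fix v assume orth: "\<And>m. m \<in> M \<Longrightarrow> cinner m v = 0"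
    have "(v, - v) \<in> A" unfolding self_adjoint_iff[OF sa, of v]
    proof (intro allI impI)
      fix x w assume "(x, w) \<in> A"
      then have "cinner (x + w) v = 0" using orth by (auto simp: M_def)
      then have "cinner v (x + w) = 0" by (metis cinner_commute complex_cnj_zero)
      then show "cinner (- v) x = cinner v w" by (simp add: cinner_add_right add_eq_0_iff)
    qed
    then have "0 \<le> Re (cinner v (- v))" by (rule nonneg_operD[OF nn])
    then show "v = 0" by (simp add: Re_cinner_self)
  qed
  then have "\<exists>x w. (x, w) \<in> A \<and> y = x + w" unfolding M_def by blast
  then show thesis using that by metis
qed


lemma unitary_cadjoint_clinear:
  assumes U: "unitary U"
  shows "cadjoint U (x + y) = cadjoint U x + cadjoint U y"
    "cadjoint U (x - y) = cadjoint U x - cadjoint U y"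
    "cadjoint U (c *\<^sub>C x) = c *\<^sub>C cadjoint U x"
    "cadjoint U (r *\<^sub>R x) = r *\<^sub>R cadjoint U x"
    "norm (cadjoint U x) = norm x"
    "cinner (cadjoint U x) (cadjoint U y) = cinner x y"
proof -
  have "bounded_clinear U" using U by (simp add: unitary_def)
  note Us = bounded_clinearD[OF this]
  have inj: "a = b" if "U a = U b" for a b using that unitary_cadjoint(1)[OF U] by metis
  show "cadjoint U (x + y) = cadjoint U x + cadjoint U y"
    by (rule inj) (simp add: Us unitary_cadjoint[OF U])
  show "cadjoint U (x - y) = cadjoint U x - cadjoint U y"
    by (rule inj) (simp add: Us unitary_cadjoint[OF U])
  show "cadjoint U (c *\<^sub>C x) = c *\<^sub>C cadjoint U x"
    by (rule inj) (simp add: Us unitary_cadjoint[OF U])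
  show "cadjoint U (r *\<^sub>R x) = r *\<^sub>R cadjoint U x"
    by (rule inj) (simp add: Us unitary_cadjoint[OF U])
  show "norm (cadjoint U x) = norm x"
    by (metis unitary_cadjoint(2)[OF U] unitary_cinner(2)[OF U])
  show "cinner (cadjoint U x) (cadjoint U y) = cinner x y"
    by (metis unitary_cadjoint(2)[OF U] unitary_cinner(1)[OF U])
qed

section \<open>The polar decomposition of a self-adjoint operator\<close>

text \<open>Split \<open>V = C + N\<close> into its self-adjoint and skew parts. By the intertwining relations
  \<open>C\<close> commutes with \<open>A\<close> and \<open>N\<close> anticommutes with it. For the form \<open>a x = \<langle>x, A x\<rangle>\<close> the identity
  \<open>C\<^sup>* C + N\<^sup>* N = I\<close> then reads \<open>a (C x) = a x + a (N x)\<close>, with a sign opposite to the usual one because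
  of the anticommutation. Iteration makes \<open>a (C\<^sup>n x)\<close> grow at least like \<open>n a (N x)\<close>, although it is
  bounded by \<open>\<parallel>x\<parallel> \<parallel>A x\<parallel>\<close> since \<open>C\<close> is a contraction. So \<open>a (N x) = 0\<close>, and \<open>N x = 0\<close> as \<open>A\<close> is
  injective.\<close>

lemma intertwining_unitary_self_adjoint:
  assumes sa: "self_adjoint A" and nn: "nonneg_oper A" and ker: "ker_oper A = {0}"
    and V: "unitary V"
    and int: "\<And>x w. (x, w) \<in> A \<Longrightarrow> (V x, cadjoint V w) \<in> A"
    and int': "\<And>x w. (x, w) \<in> A \<Longrightarrow> (cadjoint V x, V w) \<in> A"
  shows "cadjoint V = V"
proof -
  define W where "W = cadjoint V"
  define C N where "C x = (1/2::real) *\<^sub>R (V x + W x)"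
    and "N x = (1/2::real) *\<^sub>R (V x - W x)" for x
  have bV: "bounded_clinear V" using V by (simp add: unitary_def)
  note Vs = bounded_clinearD[OF bV] unitary_cinner[OF V]
  note Ws = unitary_cadjoint_clinear[OF V, folded W_def] unitary_cadjoint[OF V, folded W_def]
  have CA: "(C x, C w) \<in> A" if xw: "(x, w) \<in> A" for x w
    using self_adjointD(4)[OF sa self_adjointD(2)[OF sa int[OF xw] int'[OF xw]], of "1/2"]
    by (simp add: C_def W_def add.commute)
  have NA: "(N x, - N w) \<in> A" if xw: "(x, w) \<in> A" for x w
    using self_adjointD(4)[OF sa self_adjointD(5)[OF sa int[OF xw] int'[OF xw]], of "1/2"]
    by (simp add: N_def W_def flip: scaleR_minus_right)
  have CN: "C (N x) = N (C x)" for x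
    by (simp add: C_def N_def Vs Ws algebra_simps)
  have NN: "N (- x) = - N x" "C (- x) = - C x" for x
    using Vs(3)[of 0 x] Ws(2)[of 0 x] Vs(3)[of 0 0] Ws(2)[of 0 0] 
    by (simp_all add: N_def C_def flip: scaleR_minus_right)
  have par: "cinner (C x) (C w) + cinner (N x) (N w) = cinner x w" for x w
    by (simp add: C_def N_def cinner_scaleR_left cinner_scaleR_right cinner_add_left
        cinner_add_right cinner_diff_left cinner_diff_right add_divide_distrib
        diff_divide_distrib Vs Ws)
  have Ccontr: "norm (C x) \<le> norm x" for x
    using norm_triangle_ineq[of "V x" "W x"] by (simp add: C_def Vs Ws)
  define a where "a x w = Re (cinner x w)" for x w :: 'a
  have a_C: "a (C x) (C w) = a x w + a (N x) (- N w)" for x w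
    using arg_cong[OF par[of x w], of Re] by (simp add: a_def)
  have a_nn: "0 \<le> a x w" if "(x, w) \<in> A" for x w
    using nonneg_operD[OF nn that] by (simp add: a_def)
  have grow: "a x w + real n * a (N x) (- N w) \<le> a ((C ^^ n) x) ((C ^^ n) w)"
    if "(x, w) \<in> A" for x w n
    using that
  proof (induction n arbitrary: x w)
    case (Suc n)
    have "a (N x) (- N w) \<le> a (N (C x)) (- N (C w))"
      using a_C[of "N x" "- N w"] a_nn[OF NA[OF NA[OF Suc.prems]]] by (simp add: CN NN)
    then have "real n * a (N x) (- N w) \<le> real n * a (N (C x)) (- N (C w))"
      by (simp add: mult_left_mono)
    moreover have "a (C x) (C w) + real n * a (N (C x)) (- N (C w))
        \<le> a ((C ^^ n) (C x)) ((C ^^ n) (C w))"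
      by (rule Suc.IH[OF CA[OF Suc.prems]])
    ultimately show ?case
      using a_C[of x w] by (simp add: funpow_swap1 algebra_simps)
  qed (simp add: a_def)
  have Cn: "norm ((C ^^ n) x) \<le> norm x" for n x
    by (induction n) (auto intro: order_trans[OF Ccontr])
  have agree: "V x = W x" if "x \<in> Domain A" for x
  proof -
    from that obtain w where xw: "(x, w) \<in> A" by auto
    define q where "q = a (N x) (- N w)"
    have "real n * q \<le> norm x * norm w" for n
    proof -
      have "real n * q \<le> a ((C ^^ n) x) ((C ^^ n) w)"
        using grow[OF xw, of n] a_nn[OF xw] by (simp add: q_def)
      also have "\<dots> \<le> norm ((C ^^ n) x) * norm ((C ^^ n) w)"
        unfolding a_def by (rule Re_cinner_le)
      also have "\<dots> \<le> norm x * norm w" by (intro mult_mono Cn) auto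
      finally show ?thesis .
    qed
    then have "q \<le> 0" by (meson not_le reals_Archimedean3)
    then have "a (N x) (- N w) = 0" using a_nn[OF NA[OF xw]] by (simp add: q_def)
    then have "- N w = 0"
      by (intro nonneg_cinner_eq_zero[OF sa nn NA[OF xw]]) (simp add: a_def)
    then have "N x \<in> ker_oper A" using NA[OF xw] by (simp add: ker_oper_def)
    then show ?thesis using ker by (simp add: N_def)
  qed
  have bW: "bounded_linear W"
    by (rule bounded_linear_intro[where K=1]) (simp_all add: Ws)
  have "closed {x. V x = W x}"
    by (intro closed_Collect_eq linear_continuous_on Vs(1) bW)
  then have "closure (Domain A) \<subseteq> {x. V x = W x}"
    using agree by (intro closure_minimal) auto
  then have "V x = W x" for x using sa by (auto simp: self_adjoint_def)
  then show ?thesis by (auto simp: W_def fun_eq_iff)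
qed

text \<open>The orthogonal complement of the range of \<open>T\<close> is the kernel of its adjoint.\<close>

lemma self_adjoint_range_dense:
  assumes sa: "self_adjoint T" and ker: "ker_oper T = {0}"
    and orth: "\<And>x y. (x, y) \<in> T \<Longrightarrow> cinner y v = 0"
  shows "v = 0"
proof -
  have "cinner v y = 0" if "(x, y) \<in> T" for x y
    using orth[OF that] by (metis cinner_commute complex_cnj_zero)
  then have "(v, 0) \<in> T" unfolding self_adjoint_iff[OF sa, of v] by auto
  then show ?thesis using ker by (auto simp: ker_oper_def)
qed

text \<open>Since \<open>T = V A\<close> is self-adjoint, it is also the adjoint \<open>A V\<^sup>*\<close> of \<open>V A\<close>. This gives \<open>V A = A V\<^sup>*\<close>, equivalently the intertwining relations
  \<open>V A V = A = V\<^sup>* A V\<^sup>*\<close>.\<close>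

lemma polar_decomposition_self_adjoint:
  assumes sa: "self_adjoint T" and kerT: "ker_oper T = {0}" and pd: "polar_decomposition T V A"
  shows "unitary V" "cadjoint V = V" "\<And>x w. (x, w) \<in> A \<Longrightarrow> (V x, V w) \<in> A" "ker_oper A = {0}"
proof -
  have saA: "self_adjoint A" and nnA: "nonneg_oper A" and bV: "bounded_clinear V"
    and pi: "\<And>x. (\<forall>y. V y = 0 \<longrightarrow> cinner y x = 0) \<Longrightarrow> norm (V x) = norm x"
    and kerV: "ker_oper (graph_of V) = {0}" and TVA: "T = graph_of V \<odot> A"
    using pd kerT by (auto simp: polar_decomposition_def absolute_value_def partial_isometry_def)
  note Vs = bounded_clinearD[OF bV]
  have T_iff: "(x, y) \<in> T \<longleftrightarrow> (\<exists>w. (x, w) \<in> A \<and> y = V w)" for x y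
    by (auto simp: TVA oper_times_def graph_of_def)
  have "V y = 0 \<Longrightarrow> y = 0" for y using kerV by (auto simp: ker_oper_def graph_of_def)
  then have iso: "norm (V x) = norm x" for x using pi[of x] by (metis cinner_zero(2))
  have "range V = UNIV"
  proof (rule closed_subspace_eq_UNIV)
    show "closed (range V)" by (rule closed_range_bounded_below[OF Vs(1), of 1]) (simp_all add: iso)
    show "c *\<^sub>C m \<in> range V" if "m \<in> range V" for c m using that by (auto simp flip: Vs(4))
    show "m + m' \<in> range V" if "m \<in> range V" "m' \<in> range V" for m m'
      using that by (auto simp flip: Vs(2))
    fix v assume "\<And>m. m \<in> range V \<Longrightarrow> cinner m v = 0"
    then show "v = 0" using T_iff by (intro self_adjoint_range_dense[OF sa kerT]) auto
  qed auto
  then show U: "unitary V" by (intro surj_isometry_unitary bV iso)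
  define W where "W = cadjoint V"
  note Ws = unitary_cadjoint[OF U, folded W_def]
  \<comment> \<open>The two descriptions of \<open>T\<close> as \<open>V A\<close> and as its adjoint \<open>A V\<^sup>*\<close>.\<close>
  have T_left: "(x, y) \<in> T \<longleftrightarrow> (x, W y) \<in> A" for x y
    unfolding T_iff using Ws by metis
  have T_right: "(x, y) \<in> T \<longleftrightarrow> (W x, y) \<in> A" for x y
  proof -
    have "(x, y) \<in> T \<longleftrightarrow> (\<forall>u w. (u, w) \<in> A \<longrightarrow> cinner y u = cinner x (V w))"
      unfolding self_adjoint_iff[OF sa, of x y] by (auto simp: T_iff)
    also have "\<dots> \<longleftrightarrow> (W x, y) \<in> A"
      unfolding self_adjoint_iff[OF saA, of "W x" y] by (simp add: W_def cinner_cadjoint[OF bV])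
    finally show ?thesis .
  qed
  have int': "(W x, V w) \<in> A" if "(x, w) \<in> A" for x w
    using that T_left[of x "V w"] T_right[of x "V w"] by (simp add: Ws)
  have int: "(V x, W w) \<in> A" if "(x, w) \<in> A" for x w
    using that T_left[of "V x" w] T_right[of "V x" w] by (simp add: Ws)
  show kerA: "ker_oper A = {0}"
  proof -
    have "(x, 0) \<in> A \<longleftrightarrow> (x, 0) \<in> T" for x
      unfolding T_left using Vs(5) Ws(1)[of 0] by simp
    then show ?thesis using kerT by (simp add: ker_oper_def)
  qed
  show WV: "cadjoint V = V"
    by (rule intertwining_unitary_self_adjoint[OF saA nnA kerA U])
      (use int int' in \<open>simp_all add: W_def\<close>)
  show "(V x, V w) \<in> A" if "(x, w) \<in> A" for x w
    using int[OF that] by (simp add: W_def WV)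
qed


section \<open>The Cayley transform of a nonnegative self-adjoint operator\<close>

text \<open>The transform \<open>(I - A) (I + A)\<^sup>-\<^sup>1\<close>, written through the graph of \<open>A\<close>. The description is proper
  when \<open>I + A\<close> is bijective.\<close>

definition cayley :: "'a::complex_hilbert oper \<Rightarrow> 'a \<Rightarrow> 'a" where
  "cayley A y = (THE z. \<exists>x w. (x, w) \<in> A \<and> y = x + w \<and> z = x - w)"

lemma cayley_eq:
  assumes sa: "self_adjoint A" and nn: "nonneg_oper A" and xw: "(x, w) \<in> A"
  shows "cayley A (x + w) = x - w"
  unfolding cayley_def
proof (rule the_equality)
  fix z assume "\<exists>x' w'. (x', w') \<in> A \<and> x + w = x' + w' \<and> z = x' - w'"
  then obtain x' w' where *: "(x', w') \<in> A" "x + w = x' + w'" "z = x' - w'" by blast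
  have "norm (x - x') \<le> norm ((x - x') + (w - w'))"
    by (rule nonneg_norm_add(1)[OF nn self_adjointD(5)[OF sa xw *(1)]])
  also have "(x - x') + (w - w') = 0" using *(2) by (simp add: algebra_simps)
  finally have "x = x'" by simp
  then show "z = x - w" using * by simp
qed (use xw in blast)

text \<open>The numbers \<open>b\<^sub>n = \<parallel>K\<^sup>n u\<parallel>\<^sup>2\<close> decrease, and by symmetry
  \<open>\<parallel>K\<^sup>2\<^sup>m u - K\<^sup>2\<^sup>n u\<parallel>\<^sup>2 = b\<^sub>2\<^sub>m + b\<^sub>2\<^sub>n - 2 b\<^sub>m\<^sub>+\<^sub>n\<close>. So the even powers converge, and \<open>K\<close> preserves the norm of the
  limit, which is therefore 0.\<close>

lemma symmetric_contraction_powers_tendsto_zero: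
  fixes K :: "'a::complex_hilbert \<Rightarrow> 'a"
  assumes sym: "\<And>x y. cinner (K x) y = cinner x (K y)"
    and contr: "\<And>x. norm (K x) \<le> norm x"
    and strict: "\<And>x. norm (K x) = norm x \<Longrightarrow> x = 0"
    and diff: "\<And>x y. K (x - y) = K x - K y"
  shows "(\<lambda>n. (K ^^ n) u) \<longlonglongrightarrow> 0"
proof -
  define b where "b n = (norm ((K ^^ n) u))\<^sup>2" for n
  have "decseq b"
    by (rule decseq_SucI) (simp add: b_def contr power_mono)
  moreover have "0 \<le> b n" for n by (simp add: b_def)
  ultimately obtain l where b: "b \<longlonglongrightarrow> l" using decseq_convergent by blast
  have symp: "cinner ((K ^^ m) x) y = cinner x ((K ^^ m) y)" for m x y
  proof (induction m arbitrary: y)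
    case (Suc m)
    have "cinner ((K ^^ Suc m) x) y = cinner x ((K ^^ m) (K y))" by (simp add: sym Suc.IH)
    then show ?case by (simp add: funpow_swap1)
  qed simp
  have cross: "cinner ((K ^^ (2 * m)) u) ((K ^^ (2 * n)) u) = complex_of_real (b (m + n))" for m n
  proof -
    have "cinner ((K ^^ (2 * m)) u) ((K ^^ (2 * n)) u)
        = cinner ((K ^^ m) u) ((K ^^ m) ((K ^^ (2 * n)) u))"
      by (subst symp[symmetric]) (simp add: mult_2 funpow_add)
    also have "(K ^^ m) ((K ^^ (2 * n)) u) = (K ^^ n) ((K ^^ (m + n)) u)"
      by (simp add: mult_2 add.assoc add.left_commute flip: comp_apply[of "K ^^ _" "K ^^ _"] funpow_add)
    also have "cinner ((K ^^ m) u) \<dots> = cinner ((K ^^ (m + n)) u) ((K ^^ (m + n)) u)"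
      by (subst symp[symmetric]) (simp add: add.commute[of m n] funpow_add)
    finally show ?thesis by (simp add: cinner_self b_def)
  qed
  have "Cauchy (\<lambda>n. (K ^^ (2 * n)) u)"
  proof (rule metric_CauchyI)
    fix e :: real assume e: "e > 0"
    then have "e\<^sup>2 / 4 > 0" by simp
    with b obtain N where N: "\<And>n. n \<ge> N \<Longrightarrow> \<bar>b n - l\<bar> < e\<^sup>2 / 4"
      by (metis LIMSEQ_iff real_norm_def)
    have "dist ((K ^^ (2 * m)) u) ((K ^^ (2 * n)) u) < e" if "m \<ge> N" "n \<ge> N" for m n
    proof -
      have NN: "2 * m \<ge> N" "2 * n \<ge> N" "m + n \<ge> N" using that by simp_all
      have "(norm ((K ^^ (2 * m)) u - (K ^^ (2 * n)) u))\<^sup>2 = b (2 * m) + b (2 * n) - 2 * b (m + n)"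
        by (simp add: norm_diff_sq cross) (simp add: b_def)
      also have "\<dots> < e\<^sup>2"
        using N[OF NN(1)] N[OF NN(2)] N[OF NN(3)] unfolding abs_less_iff by linarith
      finally show ?thesis using e by (simp add: dist_norm power2_less_imp_less)
    qed
    then show "\<exists>M. \<forall>m\<ge>M. \<forall>n\<ge>M. dist ((K ^^ (2 * m)) u) ((K ^^ (2 * n)) u) < e" by blast
  qed
  then obtain z where z: "(\<lambda>n. (K ^^ (2 * n)) u) \<longlonglongrightarrow> z" using Cauchy_convergent convergent_def by blast
  have K_lim: "(\<lambda>n. K (q n)) \<longlonglongrightarrow> K p" if "q \<longlonglongrightarrow> p" for q p
  proof (rule metric_tendsto_imp_tendsto[OF that])
    show "\<forall>\<^sub>F n in sequentially. dist (K (q n)) (K p) \<le> dist (q n) p"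
      using contr by (simp add: dist_norm flip: diff)
  qed
  have "(\<lambda>n. (norm ((K ^^ (2 * n)) u))\<^sup>2) \<longlonglongrightarrow> (norm z)\<^sup>2" by (intro tendsto_intros z)
  moreover have "(\<lambda>n. b (2 * n)) \<longlonglongrightarrow> l"
    by (rule LIMSEQ_subseq_LIMSEQ[OF b, unfolded o_def]) (simp add: strict_mono_def)
  ultimately have zl: "(norm z)\<^sup>2 = l" by (simp add: b_def LIMSEQ_unique)
  have "(\<lambda>n. (norm (K ((K ^^ (2 * n)) u)))\<^sup>2) \<longlonglongrightarrow> (norm (K z))\<^sup>2" by (intro tendsto_intros K_lim z)
  moreover have "(\<lambda>n. b (Suc (2 * n))) \<longlonglongrightarrow> l"
    by (rule LIMSEQ_subseq_LIMSEQ[OF b, unfolded o_def]) (simp add: strict_mono_def)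
  ultimately have "(norm (K z))\<^sup>2 = l" by (simp add: b_def LIMSEQ_unique)
  with zl have "norm (K z) = norm z" by (metis norm_ge_zero power2_eq_imp_eq)
  then have "l = 0" using strict zl by auto
  then have "(\<lambda>n. sqrt (b n)) \<longlonglongrightarrow> sqrt 0" using b by (intro tendsto_real_sqrt) simp
  then show ?thesis by (simp add: b_def tendsto_norm_zero_iff)
qed

text \<open>If \<open>y = x + w\<close> with \<open>w = A x\<close>, then \<open>\<parallel>x + w\<parallel>\<^sup>2 - \<parallel>x - w\<parallel>\<^sup>2 = 4 \<langle>x, A x\<rangle>\<close>, so an injective \<open>A\<close> makes
  the Cayley transform strictly norm decreasing at every nonzero vector.\<close>

lemma cayley_properties:
  assumes sa: "self_adjoint A" and nn: "nonneg_oper A" and ker: "ker_oper A = {0}"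
  shows "cayley A (x + y) = cayley A x + cayley A y"
    and "cayley A (x - y) = cayley A x - cayley A y"
    and "(\<lambda>n. (cayley A ^^ n) x) \<longlonglongrightarrow> 0"
proof -
    note eq = cayley_eq[OF sa nn]
  show add: "cayley A (y + z) = cayley A y + cayley A z" for y z
  proof -
    obtain a b where ab: "(a, b) \<in> A" "y = a + b" by (rule range_id_plus_nonneg[OF sa nn])
    obtain c d where cd: "(c, d) \<in> A" "z = c + d" by (rule range_id_plus_nonneg[OF sa nn])
    have "y + z = (a + c) + (b + d)" by (simp add: ab(2) cd(2))
    then show ?thesis
      using eq[OF self_adjointD(2)[OF sa ab(1) cd(1)]] eq[OF ab(1), folded ab(2)] eq[OF cd(1), folded cd(2)] by simp
  qed
  show diff: "cayley A (y - z) = cayley A y - cayley A z" for y z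
    using add[of "y - z" z] by simp
  show "(\<lambda>n. (cayley A ^^ n) x) \<longlonglongrightarrow> 0"
  proof (rule symmetric_contraction_powers_tendsto_zero[OF _ _ _ diff])
    fix y z :: 'a
    obtain a b where ab: "(a, b) \<in> A" "y = a + b" by (rule range_id_plus_nonneg[OF sa nn])
    obtain c d where cd: "(c, d) \<in> A" "z = c + d" by (rule range_id_plus_nonneg[OF sa nn])
    have "cinner b c = cinner a d" using self_adjoint_iff[OF sa, of a b] ab(1) cd(1) by blast
    then show "cinner (cayley A y) z = cinner y (cayley A z)"
      unfolding ab(2) cd(2) eq[OF ab(1)] eq[OF cd(1)]
      by (simp add: cinner_add_left cinner_add_right cinner_diff_left cinner_diff_right)
    show "norm (cayley A y) \<le> norm y"
      unfolding ab(2) eq[OF ab(1)] by (rule nonneg_norm_add(2)[OF nn ab(1)])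
    assume "norm (cayley A y) = norm y"
    then have "(norm (a - b))\<^sup>2 = (norm (a + b))\<^sup>2" by (simp add: ab(2) eq[OF ab(1)])
    then have "b = 0"
      by (intro nonneg_cinner_eq_zero[OF sa nn ab(1)]) (simp add: norm_add_sq norm_diff_sq)
    then have "a = 0" using ab(1) ker by (auto simp: ker_oper_def)
    with \<open>b = 0\<close> show "y = 0" by (simp add: ab(2))
  qed
qed

lemma cayley_commute:
  assumes sa: "self_adjoint A" and nn: "nonneg_oper A"
    and add: "\<And>x y. V (x + y) = V x + V y" and diff: "\<And>x y. V (x - y) = V x - V y"
    and V: "\<And>x w. (x, w) \<in> A \<Longrightarrow> (V x, V w) \<in> A"
  shows "cayley A (V y) = V (cayley A y)"
proof -
  obtain x w where xw: "(x, w) \<in> A" "y = x + w" by (rule range_id_plus_nonneg[OF sa nn])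
  show ?thesis
    using cayley_eq[OF sa nn xw(1)] cayley_eq[OF sa nn V[OF xw(1)]] by (simp add: xw(2) add diff)
qed


section \<open>Sectors and phases\<close>

text \<open>With \<open>p = (I + F) u\<close> and \<open>q = (I - F) u\<close>,
  \<open>(I + F\<^sup>2) u\<close> is the mean of \<open>(I + F) p\<close> and \<open>(I - F) q\<close>, whereas
  \<open>(I - F\<^sup>2) u = (I - F) p = (I + F) q\<close>. The first term is an instance of the hypothesis. In the second
  the factors \<open>I \<plusminus> F\<close> are interchanged; taking the adjoint restores their order at the price of
  conjugating the phase and replacing \<open>J V\<close> by \<open>V J = V (J V) V\<close>, and conjugation by \<open>V\<close> is
  harmless because \<open>V\<close> commutes with \<open>F\<close>. This is why \<open>G\<close> has to be closed under conjugation.\<close>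

lemma accretive_cayley_squaring:
  fixes J V F :: "'a::complex_hilbert \<Rightarrow> 'a"
  assumes Jsym: "\<And>x y. cinner (J x) y = cinner x (J y)"
    and Vsym: "\<And>x y. cinner (V x) y = cinner x (V y)" and VV: "\<And>x. V (V x) = x"
    and V: "bounded_clinear V"
    and F: "\<And>x y. F (x + y) = F x + F y" "\<And>x y. F (x - y) = F x - F y"
    and FV: "\<And>x. F (V x) = V (F x)"
    and acc: "\<And>g u. g \<in> G \<Longrightarrow> 0 \<le> Re (g * cinner (u + F u) (J (V (u - F u))))"
    and cnj: "\<And>g. g \<in> G \<Longrightarrow> cnj g \<in> G" and g: "g \<in> G"
  shows "0 \<le> Re (g * cinner (u + F (F u)) (J (V (u - F (F u)))))"
proof -
  note Vs = bounded_clinearD[OF V]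
  define p q where "p = u + F u" and "q = u - F u"
  have plus: "u + F (F u) = (1/2::real) *\<^sub>R ((p + F p) + (q - F q))"
    by (simp add: p_def q_def F)
  have minus: "u - F (F u) = p - F p" "u - F (F u) = q + F q"
    by (simp_all add: p_def q_def F)
  define r where "r = V q"
  have Vr: "V (r - F r) = q - F q" "V (r + F r) = q + F q"
    by (simp_all add: r_def Vs VV FV)
  have "cinner (q - F q) (J (V (q + F q))) = cinner (V (r - F r)) (J (r + F r))"
    by (simp add: VV flip: Vr)
  also have "\<dots> = cnj (cinner (r + F r) (J (V (r - F r))))"
    by (metis cinner_commute Jsym)
  finally have swap: "cinner (q - F q) (J (V (q + F q))) = cnj (cinner (r + F r) (J (V (r - F r))))" .
  have "cinner (u + F (F u)) (J (V (u - F (F u))))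
      = (1/2::real) * (cinner (p + F p) (J (V (p - F p)))
          + cnj (cinner (r + F r) (J (V (r - F r)))))"
  proof -
    have "cinner (u + F (F u)) z = (1/2::real) * (cinner (p + F p) z + cinner (q - F q) z)" for z
      unfolding plus cinner_scaleR_left cinner_add_left[of "p + F p"] ..
    then show ?thesis by (metis minus swap)
  qed
  moreover have "Re (g * cnj z) = Re (cnj g * z)" for z by simp
  ultimately show ?thesis
    using acc[OF g, of p] acc[OF cnj[OF g], of r] by (simp add: algebra_simps)
qed

text \<open>For \<open>u = x + A x\<close> the Cayley transform \<open>K\<close> satisfies \<open>(I + K) u = 2 x\<close> and
  \<open>(I - K) u = 2 A x\<close>, so the hypothesis is the case \<open>F = K\<close> of the squaring lemma. The powers
  \<open>K\<close>, \<open>K\<^sup>2\<close>, \<open>K\<^sup>4\<close>, ... tend strongly to 0, where the inequality reads as claimed.\<close>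

lemma accretive_phase:
  fixes J V :: "'a::complex_hilbert \<Rightarrow> 'a"
  assumes sa: "self_adjoint A" and nn: "nonneg_oper A" and ker: "ker_oper A = {0}"
    and Jsym: "\<And>x y. cinner (J x) y = cinner x (J y)"
    and Vsym: "\<And>x y. cinner (V x) y = cinner x (V y)" and VV: "\<And>x. V (V x) = x"
    and J: "bounded_clinear J" and V: "bounded_clinear V"
    and AV: "\<And>x w. (x, w) \<in> A \<Longrightarrow> (V x, V w) \<in> A"
    and acc: "\<And>g x w. g \<in> G \<Longrightarrow> (x, w) \<in> A \<Longrightarrow> 0 \<le> Re (g * cinner x (J (V w)))"
    and cnj: "\<And>g. g \<in> G \<Longrightarrow> cnj g \<in> G" and g: "g \<in> G"
  shows "0 \<le> Re (g * cinner u (J (V u)))"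
proof -
  define K where "K = cayley A"
  note K = cayley_properties[OF sa nn ker, folded K_def]
  note Js = bounded_clinearD[OF J]
  note Vs = bounded_clinearD[OF V]
  have KV: "K (V y) = V (K y)" for y
    unfolding K_def by (rule cayley_commute[OF sa nn Vs(2,3) AV])
  define F where "F n = K ^^ (2 ^ n)" for n :: nat
  have F_Suc: "F (Suc n) x = F n (F n x)" for n x
    by (simp add: F_def mult_2 funpow_add)
  have Fadd: "F n (x + y) = F n x + F n y" and Fdiff: "F n (x - y) = F n x - F n y"
    and FV: "F n (V x) = V (F n x)" for n x y
    by (induction n arbitrary: x y) (simp_all add: F_Suc, simp_all add: F_def K KV)
  have step: "0 \<le> Re (g * cinner (u + F n u) (J (V (u - F n u))))" if "g \<in> G" for g u n
    using that
  proof (induction n arbitrary: g u)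
    case 0
    obtain x w where xw: "(x, w) \<in> A" "u = x + w" by (rule range_id_plus_nonneg[OF sa nn])
    have Ku: "K u = x - w" unfolding K_def xw(2) by (rule cayley_eq[OF sa nn xw(1)])
    have "u + F 0 u = 2 *\<^sub>R x" "u - F 0 u = 2 *\<^sub>R w"
      by (simp_all add: F_def Ku[unfolded xw(2)] xw(2) scaleR_2)
    then have "cinner (u + F 0 u) (J (V (u - F 0 u))) = 4 * cinner x (J (V w))"
      by (simp add: cinner_scaleR_left cinner_scaleR_right Js Vs)
    then show ?case using acc[OF 0 xw(1)] by (simp add: mult.left_commute[of g])
  next
    case (Suc n)
    show ?case unfolding F_Suc
      by (rule accretive_cayley_squaring[OF Jsym Vsym VV V, of "F n" G])
        (use Suc cnj in \<open>simp_all add: Fadd Fdiff FV\<close>)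
  qed
  have F0: "(\<lambda>n. F n u) \<longlonglongrightarrow> 0"
    unfolding F_def
    by (rule LIMSEQ_subseq_LIMSEQ[OF K(3), unfolded o_def]) (simp add: strict_mono_def)
  have lim: "(\<lambda>n. Re (g * cinner (u + F n u) (J (V (u - F n u)))))
      \<longlonglongrightarrow> Re (g * cinner (u + 0) (J (V (u - 0))))"
    by (intro tendsto_Re tendsto_mult tendsto_const tendsto_cinner tendsto_add F0
        bounded_linear.tendsto[OF Js(1)] bounded_linear.tendsto[OF Vs(1)] tendsto_diff)
  have "0 \<le> Re (g * cinner (u + 0) (J (V (u - 0))))"
    by (rule LIMSEQ_le_const[OF lim]) (use step[OF g] in blast)
  then show ?thesis by (simp only: add_0_right diff_zero)
qed

lemma numerical_range_phase:
  assumes lin: "linear_oper S" and nr: "\<And>z. z \<in> numerical_range S \<Longrightarrow> 0 \<le> Re (g * z)"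
    and xy: "(x, y) \<in> S"
  shows "0 \<le> Re (g * cinner x y)"
proof (cases "x = 0")
  case False
  define c where "c = 1 / norm x"
  have c: "c > 0" using False by (simp add: c_def)
  have "(c *\<^sub>R x, c *\<^sub>R y) \<in> S"
    using lin xy unfolding linear_oper_def by (metis scaleC_of_real)
  moreover have "norm (c *\<^sub>R x) = 1" using False by (simp add: c_def)
  ultimately have "cinner (c *\<^sub>R x) (c *\<^sub>R y) \<in> numerical_range S"
    unfolding numerical_range_def by blast
  from nr[OF this] have "0 \<le> Re (complex_of_real (c\<^sup>2) * (g * cinner x y))"
    by (simp add: cinner_scaleR_left cinner_scaleR_right power2_eq_square mult_ac)
  then have "0 \<le> c\<^sup>2 * Re (g * cinner x y)" by simp
  then show ?thesis using c by (simp add: zero_le_mult_iff)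
qed simp

lemma arctan_ext_bounds: "0 \<le> arctan_ext k" "arctan_ext k \<le> pi / 2"
  using arctan_ubound[of "enn2real k"] by (auto simp: arctan_ext_def zero_le_arctan_iff)

text \<open>A sector of half-angle \<open>\<theta> \<le> \<pi>/2\<close> is the intersection of two half-planes, with normals at
  angles \<open>\<plusminus>(\<pi>/2 - \<theta>)\<close>.\<close>

lemma sector_bound_phase:
  assumes acc: "accretive S" and z: "z \<in> numerical_range S"
    and \<theta>: "\<theta> = arctan_ext (sector_bound S)"
  shows "0 \<le> Re (cis (pi/2 - \<theta>) * z)" "0 \<le> Re (cnj (cis (pi/2 - \<theta>)) * z)"
proof -
  have Rez: "0 \<le> Re z" using acc z by (auto simp: accretive_def numerical_range_def)
  have "cos \<theta> * \<bar>Im z\<bar> \<le> sin \<theta> * Re z"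
  proof (cases "sector_bound S = \<infinity>")
    case True
    then show ?thesis using Rez by (simp add: \<theta> arctan_ext_def)
  next
    case False
    define k where "k = enn2real (sector_bound S)"
    have \<theta>k: "\<theta> = arctan k" using False by (simp add: \<theta> arctan_ext_def k_def)
    have sb: "sector_bound S = ennreal k" using False by (simp add: k_def top.not_eq_extremum)
    have "\<bar>Im z\<bar> \<le> k * Re z"
    proof (cases "z = 0")
      case False
      have le: "(if Re z = 0 then \<infinity> else ennreal (\<bar>Im z\<bar> / Re z)) \<le> ennreal k"
        unfolding sb[symmetric] sector_bound_def by (rule SUP_upper) (use z False in simp)
      then have R0: "Re z \<noteq> 0" by (auto simp: top_unique split: if_splits)
      then have "\<bar>Im z\<bar> / Re z \<le> k" using le by (simp add: k_def ennreal_le_iff)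
      then show ?thesis using R0 Rez by (simp add: field_simps)
    qed simp
    moreover have c: "cos \<theta> > 0" unfolding \<theta>k
      by (intro cos_gt_zero_pi arctan_lbound arctan_ubound)
    moreover have "sin \<theta> = k * cos \<theta>"
      using tan_arctan[of k] c by (simp add: \<theta>k tan_def field_simps)
    ultimately show ?thesis
      using mult_left_mono[of "\<bar>Im z\<bar>" "k * Re z" "cos \<theta>"] by (simp add: mult_ac)
  qed
  moreover have "0 \<le> cos \<theta>" using arctan_ext_bounds[of "sector_bound S"] by (intro cos_ge_zero) (auto simp: \<theta>)
  then have "\<bar>cos \<theta> * Im z\<bar> = cos \<theta> * \<bar>Im z\<bar>" by (simp add: abs_mult)
  ultimately show "0 \<le> Re (cis (pi/2 - \<theta>) * z)" "0 \<le> Re (cnj (cis (pi/2 - \<theta>)) * z)"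
    by (simp_all add: cos_diff sin_diff abs_le_iff)
qed

text \<open>The condition \<open>Re z \<ge> 0\<close> selects the square root. Knowing \<open>Re z\<^sup>2 \<ge> 0\<close> in addition to the
  two phase conditions matters only for \<open>\<theta> = 0\<close>, where these conditions alone would admit \<open>z\<^sup>2 = -1\<close>.\<close>

lemma Arg_le_half_sector:
  assumes z1: "cmod z = 1" and Rez: "0 \<le> Re z" and Rez2: "0 \<le> Re (z\<^sup>2)"
    and \<theta>: "0 \<le> \<theta>" "\<theta> \<le> pi / 2"
    and ph: "0 \<le> Re (cis (pi/2 - \<theta>) * z\<^sup>2)" "0 \<le> Re (cnj (cis (pi/2 - \<theta>)) * z\<^sup>2)"
  shows "\<bar>Arg z\<bar> \<le> \<theta> / 2"
proof -
  have quarter: "t \<le> pi / 2" if "0 \<le> cos t" "0 \<le> t" "t \<le> pi" for t :: real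
    using that cos_monotone_0_pi[of "pi/2" t] by (force simp: not_le[symmetric])
  define \<alpha> where "\<alpha> = Arg z"
  have za: "z = cis \<alpha>"
    using z1 rcis_cmod_Arg[of z] by (simp add: \<alpha>_def rcis_def)
  have z2: "z\<^sup>2 = cis (2 * \<alpha>)" by (simp add: za power2_eq_square cis_mult)
  have "\<bar>\<alpha>\<bar> \<le> pi" using Arg_bounded[of z] by (simp add: \<alpha>_def abs_le_iff)
  moreover have "0 \<le> cos \<bar>\<alpha>\<bar>" using Rez by (simp add: za)
  ultimately have "\<bar>\<alpha>\<bar> \<le> pi / 2" using quarter by simp
  moreover have "cos (2 * \<bar>\<alpha>\<bar>) = cos (2 * \<alpha>)" by (simp add: abs_if)
  then have "0 \<le> cos (2 * \<bar>\<alpha>\<bar>)" using Rez2 by (simp add: z2)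
  ultimately have a: "2 * \<bar>\<alpha>\<bar> \<le> pi / 2" using quarter[of "2 * \<bar>\<alpha>\<bar>"] by simp
  have "0 \<le> cos (pi/2 - \<theta> + 2 * \<alpha>)"
    using ph(1) unfolding z2 cis_mult by simp
  moreover have "0 \<le> cos (pi/2 - \<theta> - 2 * \<alpha>)"
    using ph(2) cos_minus[of "pi/2 - \<theta> - 2 * \<alpha>"] unfolding z2 cis_cnj cis_mult
    by (simp add: algebra_simps)
  ultimately have "0 \<le> cos (pi/2 - \<theta> + 2 * \<bar>\<alpha>\<bar>)" by (auto simp: abs_if)
  then have "pi/2 - \<theta> + 2 * \<bar>\<alpha>\<bar> \<le> pi / 2" 
    using quarter[of "pi/2 - \<theta> + 2 * \<bar>\<alpha>\<bar>"] a \<theta> by simp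
  then show ?thesis by (simp add: \<alpha>_def)
qed


section \<open>Direct rotations\<close>

theorem theorem3p4:
  fixes J J' :: "'a::complex_hilbert \<Rightarrow> 'a"
    and T absT :: "'a oper"
  assumes "involution J"
    and "self_adjoint T"
    and "ker_oper T = {0}"
    and "accretive (graph_of J \<odot> T)"
    and "polar_decomposition T J' absT"
  shows "acute_case J J' \<and>
    (\<forall>U. direct_rotation J J' U \<longrightarrow>
       spectral_angle U \<le> ennreal (1/2 * arctan_ext (sector_bound (graph_of J \<odot> T)))) \<and>
    1/2 * arctan_ext (sector_bound (graph_of J \<odot> T)) \<le> pi / 4"
proof -
  note polar = polar_decomposition_self_adjoint[OF assms(2,3,5)]
  have sa: "self_adjoint absT" and nn: "nonneg_oper absT"
    using assms(5) by (auto simp: polar_decomposition_def absolute_value_def)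
  have J: "bounded_clinear J" and J': "bounded_clinear J'"
    using assms(1) polar(1) by (auto simp: involution_def unitary_def)
  note Js = bounded_clinearD[OF J]
  note J's = bounded_clinearD[OF J']
  have JJ: "J (J x) = x" for x using assms(1) by (simp add: involution_def fun_eq_iff)
  have J'J': "J' (J' x) = x" for x using unitary_cadjoint(1)[OF polar(1)] by (simp add: polar(2))
  have Jsym: "cinner (J x) y = cinner x (J y)" for x y
    using cinner_cadjoint[OF J] assms(1) by (simp add: involution_def)
  have J'sym: "cinner (J' x) y = cinner x (J' y)" for x y
    using cinner_cadjoint[OF J'] by (simp add: polar(2))
  define S where "S = graph_of J \<odot> T"
  have S: "(x, J (J' w)) \<in> S" if "(x, w) \<in> absT" for x w
  proof -
    have "(x, J' w) \<in> T"
      using assms(5) that by (auto simp: polar_decomposition_def oper_times_def graph_of_def)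
    then show ?thesis by (auto simp: S_def oper_times_def graph_of_def)
  qed
  have accS: "accretive S" using assms(4) by (simp add: S_def)
  then have linS: "linear_oper S" by (simp add: accretive_def)
  define \<theta> where "\<theta> = arctan_ext (sector_bound S)"
  \<comment> \<open>The phase 1 stands for accretivity itself, the other two for the sector.\<close>
  define G where "G = {1, cis (pi/2 - \<theta>), cnj (cis (pi/2 - \<theta>))}"
  have phase: "0 \<le> Re (g * cinner u (J (J' u)))" if "g \<in> G" for g u
  proof (rule accretive_phase[OF sa nn polar(4) Jsym J'sym J'J' J J' polar(3) _ _ that])
    fix g x w assume g: "g \<in> G" and xw: "(x, w) \<in> absT"
    have "0 \<le> Re (g * z)" if z: "z \<in> numerical_range S" for z
      using g sector_bound_phase[OF accS z \<theta>_def] accS z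
      by (auto simp: G_def accretive_def numerical_range_def)
    then show "0 \<le> Re (g * cinner x (J (J' w)))"
      by (rule numerical_range_phase[OF linS _ S[OF xw]])
  next
    show "cnj g \<in> G" if "g \<in> G" for g using that by (auto simp: G_def)
  qed
  have inj: "x = 0" if "x + J' (J x) = 0" for x
  proof -
    have "J' (J x) = - x" using that by (simp add: add_eq_0_iff)
    then have "J x = J' (- x)" by (metis J'J')
    then have "x = J (J' (- x))" by (metis JJ)
    moreover have "J (J' (- x)) = - J (J' x)" using Js(3)[of 0] J's(3)[of 0] Js(5) J's(5) by simp
    ultimately have "J (J' x) = - x" by (metis minus_minus)
    then show "x = 0" using phase[of 1 x] by (simp add: G_def Re_cinner_self)
  qed
  have "x + J' (J x) = 0 \<longleftrightarrow> x = 0" for x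
    using inj[of x] by (auto simp: Js(5) J's(5))
  then have "ker_oper (graph_of (\<lambda>x. x + J' (J x))) = {0}"
    by (simp add: ker_oper_def graph_of_def)
  moreover have "J' \<circ> J' = id" using J'J' by (simp add: fun_eq_iff)
  ultimately have "acute_case J J'"
    using assms(1) J' polar(2) by (simp add: acute_case_def involution_def)
  moreover have "spectral_angle U \<le> ennreal (1/2 * \<theta>)" if "direct_rotation J J' U" for U
    unfolding spectral_angle_def
  proof (rule SUP_least)
    fix z assume z: "z \<in> spectrum U"
    have U: "unitary U" and UU': "U \<circ> U = J' \<circ> J" and ReU: "nonneg_oper (graph_of (real_part U))"
      using that by (simp_all add: direct_rotation_def)
    have UU: "U (U x) = J' (J x)" for x using fun_cong[OF UU', of x] by simp
    have bU: "bounded_clinear U" using U by (simp add: unitary_def)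
    define R where "R = {(a, b). 0 \<le> Re a \<and> (\<forall>g\<in>G. 0 \<le> Re (g * b))}"
    have "R = {p. 0 \<le> Re (fst p)} \<inter> (\<Inter>g\<in>G. {p. 0 \<le> Re (g * snd p)})"
      by (auto simp: R_def)
    then have "closed R"
      by (auto intro!: closed_Int closed_INT closed_Collect_le continuous_intros)
    moreover have "(cinner x (U x), cinner x (U (U x))) \<in> R" for x
    proof -
      have "0 \<le> Re (cinner x (real_part U x))"
        using nonneg_operD[OF ReU, of x "real_part U x"] by (auto simp: graph_of_def)
      moreover have "Re (cinner x (cadjoint U x)) = Re (cinner x (U x))"
        using cinner_cadjoint[OF bU, of x x] Re_cinner_commute[of x "cadjoint U x"] by simp
      ultimately have "0 \<le> Re (cinner x (U x))"
        by (simp add: real_part_def cinner_scaleR_right cinner_add_right)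
      moreover have "cinner x (J' (J x)) = cnj (cinner x (J (J' x)))"
        by (metis Jsym J'sym cinner_commute)
      then have "0 \<le> Re (g * cinner x (U (U x)))" if "g \<in> G" for g
        using phase[of "cnj g" x] that by (auto simp: UU G_def)
      ultimately show ?thesis by (simp add: R_def)
    qed
    ultimately have "cmod z = 1" and zR: "(z, z\<^sup>2) \<in> R"
      using unitary_spectrum_closed[OF U z] by auto
    then have "\<bar>Arg z\<bar> \<le> \<theta> / 2"
      using arctan_ext_bounds[of "sector_bound S"]
      by (intro Arg_le_half_sector) (auto simp: R_def G_def simp flip: \<theta>_def)
    then show "ennreal \<bar>Arg z\<bar> \<le> ennreal (1/2 * \<theta>)" by (intro ennreal_leI) simp
  qed
  moreover have "1/2 * \<theta> \<le> pi / 4"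
    using arctan_ext_bounds[of "sector_bound S"] by (simp add: \<theta>_def)
  ultimately show ?thesis by (simp add: \<theta>_def S_def)
qed

end
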